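(* Let $K\subseteq\mathbb H^n$ be closed, and let $\mathbf y=(y_w)_{w\in\mathcal W}$, $y_w\in\mathbb H$, be a quaternion-valued quaternionic pseudo-moment sequence. The following are equivalent. (i) The sequence $\mathbf y$ admits a positive Borel $K$-representing measure. (ii) For every $p\in\mathcal P_K^{\mathbb H}$, one has $L_{\mathbf y}^{\mathcal R}(p)\ge0$.
   Context: $\mathbb H$ is the skew field of quaternions, $\mathcal R(a)$ the real part of $a\in\mathbb H$. Fix $n\ge1$ and letters $q_1,\dots,q_n,\bar q_1,\dots,\bar q_n$. $\mathcal W$ is the set of words (including the empty word $1$) in these letters, where words with the same normal form are identified: any consecutive factor $q_i\bar q_i$ or $\bar q_iq_i$ is written $|q_i|^2$ and moved to the front, so each word is uniquely $\prod_i|q_i|^{2\alpha_i}\tilde w$ with $\tilde w$ containing no such factor. $w^*$ is obtained by reversing $w$ and exchanging $q_i\leftrightarrow\bar q_i$. $\mathbb R\langle\mathbf q,\bar{\mathbf q}\rangle$ is the real $*$-algebra of finite sums $\sum_wp_ww$, $p_w\in\mathbb R$. $\mathbb H\langle\mathbf q,\bar{\mathbf q}\rangle$ is the real free product of $\mathbb H$ (involution: conjugation) and $\mathbb R\langle\mathbf q,\bar{\mathbf q}\rangle$; constants do not commute with letters. $\mathscr P\langle\mathbf q,\bar{\mathbf q}\rangle\subset\mathbb H\langle\mathbf q,\bar{\mathbf q}\rangle$ is the space of finite sums $p=\sum_{a,b\in\mathcal W}a\,p_{a,b}\,b$, $p_{a,b}\in\mathbb H$, with $p^*=\sum b^*\bar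 p_{a,b}a^*$; $\operatorname{Sym}\mathscr P\langle\mathbf q,\bar{\mathbf q}\rangle$ is the set of those with $p=p^*$ (they take real values under evaluations $q_i\mapsto a_i$, $\bar q_i\mapsto\bar a_i$, $\mathbf a\in\mathbb H^n$). Words $u,v$ are cyclically equivalent, $u\stackrel{\mathrm{cyc}}{\sim}v$, if $u=w_1w_2$, $v=w_2w_1$ for some words $w_1,w_2$. A sequence $\mathbf y=(y_w)_{w\in\mathcal W}$ in $\mathbb H$ is a quaternionic pseudo-moment sequence if $y_w=\overline{y_{w^*}}$ for all $w$ and $\mathcal R(y_u)=\mathcal R(y_v)$ whenever $u\stackrel{\mathrm{cyc}}{\sim}v$. It defines the real-linear functional $L_{\mathbf y}^{\mathcal R}:\mathscr P\langle\mathbf q,\bar{\mathbf q}\rangle\to\mathbb R$, $L_{\mathbf y}^{\mathcal R}\big(\sum_{a,b}a\,p_{a,b}\,b\big)=\mathcal R\big(\sum_{a,b}p_{a,b}\,y_{ba}\big)$. A positive Borel measure $\mu$ on $K$ is a $K$-representing measure for $\mathbf y$ if $y_w=\int_Kw(\mathbf a,\bar{\mathbf a})\,d\mu(\mathbf a)$ for all $w\in\mathcal W$ (quaternion-valued integrals taken componentwise, all finite). $\mathcal P_K^{\mathbb H}=\{p\in\operatorname{Sym}\mathscr P\langle\mathbf q,\bar{\mathbf q}\rangle:p(\mathbf a,\bar{\mathbf a})\ge0\ \forall\mathbf a\in K\}$. *)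

theory Defs
  imports "HOL-Analysis.Analysis" "HOL-Library.Poly_Mapping"
begin

section \<open>Quaternions\<close>

datatype quat = Quat (qRe: real) (qI: real) (qJ: real) (qK: real)

lemma quat_eqI: "qRe x = qRe y \<Longrightarrow> qI x = qI y \<Longrightarrow> qJ x = qJ y \<Longrightarrow> qK x = qK y \<Longrightarrow> x = y"
  by (cases x; cases y) simp

lemma quat_eq_iff: "x = y \<longleftrightarrow> qRe x = qRe y \<and> qI x = qI y \<and> qJ x = qJ y \<and> qK x = qK y"
  by (auto intro: quat_eqI)

instantiation quat :: ring_1
begin

definition zero_quat :: quat where "0 = Quat 0 0 0 0"
definition one_quat :: quat where "1 = Quat 1 0 0 0"
definition plus_quat :: "quat \<Rightarrow> quat \<Rightarrow> quat" where
  "x + y = Quat (qRe x + qRe y) (qI x + qI y) (qJ x + qJ y) (qK x + qK y)"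
definition uminus_quat :: "quat \<Rightarrow> quat" where
  "- x = Quat (- qRe x) (- qI x) (- qJ x) (- qK x)"
definition minus_quat :: "quat \<Rightarrow> quat \<Rightarrow> quat" where
  "x - y = Quat (qRe x - qRe y) (qI x - qI y) (qJ x - qJ y) (qK x - qK y)"
definition times_quat :: "quat \<Rightarrow> quat \<Rightarrow> quat" where
  "x * y = Quat
     (qRe x * qRe y - qI x * qI y - qJ x * qJ y - qK x * qK y)
     (qRe x * qI y + qI x * qRe y + qJ x * qK y - qK x * qJ y)
     (qRe x * qJ y - qI x * qK y + qJ x * qRe y + qK x * qI y)
     (qRe x * qK y + qI x * qJ y - qJ x * qI y + qK x * qRe y)"

lemma quat_sel [simp]:
  "qRe 0 = 0" "qI 0 = 0" "qJ 0 = 0" "qK 0 = 0"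
  "qRe 1 = 1" "qI 1 = 0" "qJ 1 = 0" "qK 1 = 0"
  "qRe (x + y) = qRe x + qRe y" "qI (x + y) = qI x + qI y"
  "qJ (x + y) = qJ x + qJ y" "qK (x + y) = qK x + qK y"
  "qRe (- x) = - qRe x" "qI (- x) = - qI x" "qJ (- x) = - qJ x" "qK (- x) = - qK x"
  "qRe (x - y) = qRe x - qRe y" "qI (x - y) = qI x - qI y"
  "qJ (x - y) = qJ x - qJ y" "qK (x - y) = qK x - qK y"
  by (simp_all add: zero_quat_def one_quat_def plus_quat_def uminus_quat_def minus_quat_def)

lemma quat_times_sel [simp]:
  "qRe (x * y) = qRe x * qRe y - qI x * qI y - qJ x * qJ y - qK x * qK y"
  "qI (x * y) = qRe x * qI y + qI x * qRe y + qJ x * qK y - qK x * qJ y"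
  "qJ (x * y) = qRe x * qJ y - qI x * qK y + qJ x * qRe y + qK x * qI y"
  "qK (x * y) = qRe x * qK y + qI x * qJ y - qJ x * qI y + qK x * qRe y"
  by (simp_all add: times_quat_def)

instance
  by standard (simp_all add: quat_eq_iff algebra_simps)

end

instantiation quat :: real_algebra_1
begin

definition scaleR_quat :: "real \<Rightarrow> quat \<Rightarrow> quat" where
  "scaleR r x = Quat (r * qRe x) (r * qI x) (r * qJ x) (r * qK x)"

instance
  by standard (auto simp: scaleR_quat_def quat_eq_iff algebra_simps)

end

lemma quat_scaleR_sel [simp]:
  "qRe (scaleR r x) = r * qRe x" "qI (scaleR r x) = r * qI x"
  "qJ (scaleR r x) = r * qJ x" "qK (scaleR r x) = r * qK x"
  by (simp_all add: scaleR_quat_def)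

lemma quat_of_real_sel [simp]:
  "qRe (of_real r) = r" "qI (of_real r) = 0" "qJ (of_real r) = 0" "qK (of_real r) = 0"
  by (simp_all add: of_real_def)

definition qcnj :: "quat \<Rightarrow> quat" where
  "qcnj x = Quat (qRe x) (- qI x) (- qJ x) (- qK x)"

lemma qcnj_sel [simp]:
  "qRe (qcnj x) = qRe x" "qI (qcnj x) = - qI x" "qJ (qcnj x) = - qJ x" "qK (qcnj x) = - qK x"
  by (simp_all add: qcnj_def)

lemma qcnj_simps [simp]:
  "qcnj 0 = 0" "qcnj 1 = 1" "qcnj (of_real r) = of_real r" "qcnj (qcnj x) = x"
  "qcnj (x + y) = qcnj x + qcnj y" "qcnj (x * y) = qcnj y * qcnj x"
  by (auto simp: quat_eq_iff)

instantiation quat :: real_inner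
begin

definition inner_quat :: "quat \<Rightarrow> quat \<Rightarrow> real" where
  "inner x y = qRe x * qRe y + qI x * qI y + qJ x * qJ y + qK x * qK y"
definition norm_quat :: "quat \<Rightarrow> real" where "norm (x::quat) = sqrt (inner x x)"
definition sgn_quat :: "quat \<Rightarrow> quat" where "sgn (x::quat) = x /\<^sub>R norm x"
definition dist_quat :: "quat \<Rightarrow> quat \<Rightarrow> real" where "dist x y = norm (x - y :: quat)"
definition uniformity_quat :: "(quat \<times> quat) filter" where
  "uniformity = (INF e\<in>{0 <..}. principal {(x, y :: quat). dist x y < e})"
definition open_quat :: "quat set \<Rightarrow> bool" where
  "open (U :: quat set) \<longleftrightarrow> (\<forall>x\<in>U. eventually (\<lambda>(x', y). x' = x \<longrightarrow> y \<in> U) uniformity)"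

instance
proof
  fix x y z :: quat and r :: real
  show "0 \<le> inner x x" by (simp add: inner_quat_def)
  show "inner x x = 0 \<longleftrightarrow> x = 0"
  proof
    assume "inner x x = 0"
    then have "(qRe x)\<^sup>2 + (qI x)\<^sup>2 + (qJ x)\<^sup>2 + (qK x)\<^sup>2 = 0"
      by (simp add: inner_quat_def power2_eq_square)
    then show "x = 0"
      by (simp add: quat_eq_iff add_nonneg_eq_0_iff)
  qed (simp add: inner_quat_def)
qed (auto simp: inner_quat_def norm_quat_def sgn_quat_def dist_quat_def uniformity_quat_def
    open_quat_def algebra_simps)

end

instantiation quat :: euclidean_space
begin

definition Basis_quat :: "quat set" where
  "Basis = {Quat 1 0 0 0, Quat 0 1 0 0, Quat 0 0 1 0, Quat 0 0 0 1}"

instance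
proof
  fix x u v :: quat
  show "inner u v = (if u = v then 1 else 0)" if "u \<in> Basis" "v \<in> Basis"
    using that unfolding Basis_quat_def inner_quat_def by (elim insertE emptyE; simp)
  show "(\<forall>u\<in>Basis. inner x u = 0) \<longleftrightarrow> x = 0"
    by (auto simp: Basis_quat_def inner_quat_def intro: quat_eqI)
  show "(Basis :: quat set) \<noteq> {}" "finite (Basis :: quat set)"
    by (simp_all add: Basis_quat_def)
qed

end

instantiation quat :: real_normed_div_algebra
begin

definition inverse_quat :: "quat \<Rightarrow> quat" where "inverse x = qcnj x /\<^sub>R inner x x"
definition divide_quat :: "quat \<Rightarrow> quat \<Rightarrow> quat" where "x div y = x * inverse (y::quat)"

instance
proof
  fix x y :: quat
  have cnj: "of_real (inner z z) = z * qcnj z" "of_real (inner z z) = qcnj z * z" for z :: quat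
    by (simp_all add: quat_eq_iff inner_quat_def algebra_simps)
  have "(of_real (inner (x * y) (x * y)) :: quat) = x * of_real (inner y y) * qcnj x"
    by (simp only: cnj(1) qcnj_simps mult.assoc)
  also have "\<dots> = of_real (inner y y) * (x * qcnj x)"
    by (simp add: of_real_def)
  finally have "(of_real (inner (x * y) (x * y)) :: quat) = of_real (inner x x * inner y y)"
    by (simp only: cnj(1)[symmetric] of_real_mult[symmetric] mult.commute[of "inner y y"])
  then have "inner (x * y) (x * y) = inner x x * inner y y"
    by (simp only: of_real_eq_iff)
  then show "norm (x * y) = norm x * norm y"
    by (simp add: norm_quat_def real_sqrt_mult)
  show "inverse x * x = 1" if "x \<noteq> 0"
  proof -
    have "inner x x \<noteq> 0" using that by simp
    then show ?thesis
      by (simp add: inverse_quat_def cnj(2)[symmetric]) (simp add: of_real_def)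
  qed
  show "x * inverse x = 1" if "x \<noteq> 0"
  proof -
    have "inner x x \<noteq> 0" using that by simp
    then show ?thesis
      by (simp add: inverse_quat_def cnj(1)[symmetric]) (simp add: of_real_def)
  qed
  show "inverse (0::quat) = 0" by (simp add: inverse_quat_def)
qed (rule divide_quat_def)

end

lemma qcnj_mult_self: "x * qcnj x = of_real ((norm x)\<^sup>2)" "qcnj x * x = of_real ((norm x)\<^sup>2)"
  by (simp_all add: quat_eq_iff norm_quat_def inner_quat_def algebra_simps)


section \<open>Words\<close>

datatype 'n letter = Q 'n | Qbar 'n

primrec idx :: "'n letter \<Rightarrow> 'n" where
  "idx (Q i) = i" | "idx (Qbar i) = i"

primrec bar :: "'n letter \<Rightarrow> 'n letter" where
  "bar (Q i) = Qbar i" | "bar (Qbar i) = Q i"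

lemma bar_simps [simp]: "bar (bar l) = l" "idx (bar l) = idx l" "bar l \<noteq> l" "l \<noteq> bar l"
  by (cases l; simp)+

lemma bar_eq_iff [simp]: "bar l = bar m \<longleftrightarrow> l = m"
  by (metis bar_simps(1))

text \<open>
  A pair \<open>(\<alpha>, w)\<close> with \<open>w\<close> reduced stands for the normal form consisting of the factors
  \<open>|q\<^sub>i|\<close> to the power \<open>2 \<alpha> i\<close>, followed by \<open>w\<close>. Prepending a letter to a word that starts with
  the conjugate letter removes both and moves a factor \<open>|q\<^sub>i|\<^sup>2\<close> to the front.
\<close>

type_synonym 'n nform = "('n \<Rightarrow> nat) \<times> 'n letter list"

fun nf_cons :: "'n letter \<Rightarrow> 'n nform \<Rightarrow> 'n nform" where
  "nf_cons l (\<alpha>, []) = (\<alpha>, [l])"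
| "nf_cons l (\<alpha>, m # w) =
     (if m = bar l then (\<alpha>(idx l := Suc (\<alpha> (idx l))), w) else (\<alpha>, l # m # w))"

definition nf :: "'n letter list \<Rightarrow> 'n nform" where
  "nf ls = foldr nf_cons ls (\<lambda>_. 0, [])"

fun reduced :: "'n letter list \<Rightarrow> bool" where
  "reduced (l # m # w) \<longleftrightarrow> m \<noteq> bar l \<and> reduced (m # w)"
| "reduced _ \<longleftrightarrow> True"

definition list_star :: "'n letter list \<Rightarrow> 'n letter list" where
  "list_star ls = rev (map bar ls)"

definition nf_add :: "('n \<Rightarrow> nat) \<Rightarrow> 'n nform \<Rightarrow> 'n nform" where
  "nf_add \<alpha> s = (\<lambda>i. \<alpha> i + fst s i, snd s)"

lemma reduced_ConsD: "reduced (l # w) \<Longrightarrow> reduced w"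
  by (cases w) auto

lemma reduced_nf_cons: "reduced (snd s) \<Longrightarrow> reduced (snd (nf_cons l s))"
  by (cases "(l, s)" rule: nf_cons.cases) (auto dest: reduced_ConsD)

lemma reduced_foldr: "reduced (snd s) \<Longrightarrow> reduced (snd (foldr nf_cons ls s))"
  by (induction ls) (auto intro: reduced_nf_cons)

lemma reduced_nf: "reduced (snd (nf ls))"
  unfolding nf_def by (rule reduced_foldr) simp

lemma nf_reduced: "reduced ls \<Longrightarrow> nf ls = (\<lambda>_. 0, ls)"
proof (induction ls)
  case (Cons l ls)
  then have "nf ls = (\<lambda>_. 0, ls)" by (auto dest: reduced_ConsD)
  with Cons.prems show ?case by (cases ls) (auto simp: nf_def)
qed (simp add: nf_def)

lemma nf_cons_nf_add: "nf_cons l (nf_add \<alpha> s) = nf_add \<alpha> (nf_cons l s)"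
  by (cases "(l, s)" rule: nf_cons.cases) (auto simp: nf_add_def fun_eq_iff)

lemma foldr_nf_add: "foldr nf_cons ls (nf_add \<alpha> s) = nf_add \<alpha> (foldr nf_cons ls s)"
  by (induction ls) (auto simp: nf_cons_nf_add)

lemma nf_cons_cancel:
  assumes "reduced (snd s)"
  shows "nf_cons l (nf_cons (bar l) s) = nf_add (\<lambda>i. if i = idx l then 1 else 0) s"
proof (cases "(l, s)" rule: nf_cons.cases)
  case (2 l' \<alpha> m w)
  then show ?thesis using assms by (cases w) (auto simp: nf_add_def fun_eq_iff)
qed (auto simp: nf_add_def fun_eq_iff)

lemma nf_add_add: "nf_add \<alpha> (nf_add \<beta> s) = nf_add (\<lambda>i. \<alpha> i + \<beta> i) s"
  by (simp add: nf_add_def add.assoc)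

lemma foldr_nf:
  assumes "reduced (snd s)"
  shows "foldr nf_cons ls s = nf_add (fst (nf ls)) (foldr nf_cons (snd (nf ls)) s)"
proof (induction ls)
  case Nil
  then show ?case by (simp add: nf_def nf_add_def)
next
  case (Cons l ls)
  obtain \<alpha> w where n: "nf ls = (\<alpha>, w)" by (cases "nf ls")
  have n': "nf (l # ls) = nf_cons l (\<alpha>, w)" using n by (simp add: nf_def)
  have step: "foldr nf_cons (l # ls) s = nf_add \<alpha> (nf_cons l (foldr nf_cons w s))"
    using Cons n by (simp add: nf_cons_nf_add)
  show ?case
  proof (cases "\<exists>w'. w = bar l # w'")
    case True
    then obtain w' where w: "w = bar l # w'" by blast
    have "nf_cons l (nf_cons (bar l) (foldr nf_cons w' s)) =
        nf_add (\<lambda>i. if i = idx l then 1 else 0) (foldr nf_cons w' s)"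
      by (rule nf_cons_cancel) (rule reduced_foldr[OF assms])
    then show ?thesis unfolding step n' w
      by (simp add: nf_add_add) (simp add: nf_add_def fun_eq_iff)
  next
    case False
    then have "nf_cons l (\<alpha>, w) = (\<alpha>, l # w)" by (cases w) auto
    then show ?thesis unfolding step n' by simp
  qed
qed

lemma nf_append: "nf (u @ v) = nf_add (fst (nf u)) (foldr nf_cons (snd (nf u)) (nf v))"
  using foldr_nf[of "nf v" u] reduced_nf[of v] by (simp add: nf_def)

lemma reduced_snoc2: "reduced (w @ [l, m]) \<longleftrightarrow> reduced (w @ [l]) \<and> m \<noteq> bar l"
  by (induction w rule: reduced.induct) auto

lemma reduced_list_star: "reduced w \<Longrightarrow> reduced (list_star w)"
proof (induction w rule: reduced.induct)
  case (1 l m w)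
  then show ?case by (auto simp: list_star_def reduced_snoc2)
qed (auto simp: list_star_def)

lemma nf_list_star: "nf (list_star ls) = (fst (nf ls), list_star (snd (nf ls)))"
proof (induction ls)
  case Nil
  then show ?case by (simp add: nf_def list_star_def)
next
  case (Cons l ls)
  obtain \<alpha> w where n: "nf ls = (\<alpha>, w)" by (cases "nf ls")
  have rw: "reduced w" using reduced_nf[of ls] n by simp
  have n': "nf (l # ls) = nf_cons l (\<alpha>, w)" using n by (simp add: nf_def)
  have s: "list_star (l # ls) = list_star ls @ [bar l]" by (simp add: list_star_def)
  have e: "nf (list_star (l # ls)) = nf_add \<alpha> (foldr nf_cons (list_star w) (nf [bar l]))"
    unfolding s nf_append Cons.IH n by simp
  have b: "foldr nf_cons (list_star w) (nf [bar l]) = nf (list_star w @ [bar l])"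
    by (simp add: nf_def)
  show ?case
  proof (cases "\<exists>w'. w = bar l # w'")
    case True
    then obtain w' where w: "w = bar l # w'" by blast
    have r': "reduced (list_star w')" using rw w by (auto intro: reduced_list_star dest: reduced_ConsD)
    have "nf (list_star w @ [bar l]) = foldr nf_cons (list_star w') (nf [l, bar l])"
      by (simp add: w list_star_def nf_def)
    also have "nf [l, bar l] = nf_add (\<lambda>i. if i = idx l then 1 else 0) (nf [])"
      by (simp add: nf_def nf_add_def fun_eq_iff)
    also have "foldr nf_cons (list_star w') (nf_add (\<lambda>i. if i = idx l then 1 else 0) (nf [])) =
        nf_add (\<lambda>i. if i = idx l then 1 else 0) (nf (list_star w'))"
      by (simp add: nf_def foldr_nf_add)
    also have "nf (list_star w') = (\<lambda>_. 0, list_star w')" by (rule nf_reduced[OF r'])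
    finally show ?thesis unfolding e b n' unfolding w
      by (simp add: nf_add_add) (simp add: nf_add_def fun_eq_iff)
  next
    case False
    then have c: "nf_cons l (\<alpha>, w) = (\<alpha>, l # w)" and rl: "reduced (l # w)"
      using rw by (cases w; auto)+
    have "list_star w @ [bar l] = list_star (l # w)" by (simp add: list_star_def)
    then have "nf (list_star w @ [bar l]) = (\<lambda>_. 0, list_star (l # w))"
      using nf_reduced[OF reduced_list_star[OF rl]] by simp
    then show ?thesis unfolding e b n' c by (simp add: nf_add_def)
  qed
qed

quotient_type 'n word = "'n letter list" / "\<lambda>u v. nf u = nf v"
  by (rule equivpI) (auto simp: reflp_def symp_def transp_def)

instantiation word :: (type) monoid_mult
begin

lift_definition one_word :: "'a word" is "[]" .
lift_definition times_word :: "'a word \<Rightarrow> 'a word \<Rightarrow> 'a word" is "(@)"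
  by (simp add: nf_append)

instance
  by standard (transfer; simp)+

end

lift_definition word_star :: "'n word \<Rightarrow> 'n word" is list_star
  by (simp add: nf_list_star)

lemma word_star_simps [simp]:
  "word_star 1 = 1" "word_star (u * v) = word_star v * word_star u" "word_star (word_star u) = u"
  by (transfer; simp add: list_star_def rev_map comp_def)+

primrec letter_eval :: "quat ^ 'n \<Rightarrow> 'n letter \<Rightarrow> quat" where
  "letter_eval a (Q i) = a $ i"
| "letter_eval a (Qbar i) = qcnj (a $ i)"

definition list_eval :: "quat ^ 'n \<Rightarrow> 'n letter list \<Rightarrow> quat" where
  "list_eval a ls = prod_list (map (letter_eval a) ls)"

lemma letter_eval_bar: "letter_eval a l * letter_eval a (bar l) = of_real ((norm (a $ idx l))\<^sup>2)"
  by (cases l) (simp_all add: qcnj_mult_self)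

lemma list_eval_nf:
  fixes a :: "quat ^ 'n::finite"
  shows "list_eval a ls =
    of_real (\<Prod>i\<in>UNIV. (norm (a $ i)) ^ (2 * fst (nf ls) i)) * list_eval a (snd (nf ls))"
proof (induction ls)
  case Nil
  then show ?case by (simp add: nf_def list_eval_def)
next
  case (Cons l ls)
  obtain \<alpha> w where n: "nf ls = (\<alpha>, w)" by (cases "nf ls")
  have n': "nf (l # ls) = nf_cons l (\<alpha>, w)" using n by (simp add: nf_def)
  let ?c = "\<lambda>\<alpha>. \<Prod>i\<in>UNIV. (norm (a $ i)) ^ (2 * \<alpha> i)"
  have "list_eval a (l # ls) = letter_eval a l * (of_real (?c \<alpha>) * list_eval a w)"
    using Cons n by (simp add: list_eval_def)
  also have "\<dots> = of_real (?c \<alpha>) * (letter_eval a l * list_eval a w)"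
    by (simp add: of_real_def)
  finally have e: "list_eval a (l # ls) = of_real (?c \<alpha>) * (letter_eval a l * list_eval a w)" .
  show ?case
  proof (cases "\<exists>w'. w = bar l # w'")
    case True
    then obtain w' where w: "w = bar l # w'" by blast
    have "?c (\<alpha>(idx l := Suc (\<alpha> (idx l)))) =
        (\<Prod>i\<in>UNIV. (norm (a $ i)) ^ (2 * \<alpha> i) * (if i = idx l then (norm (a $ i))\<^sup>2 else 1))"
      by (rule prod.cong) (auto simp: power2_eq_square)
    also have "\<dots> = ?c \<alpha> * (norm (a $ idx l))\<^sup>2"
      unfolding prod.distrib by (simp add: prod.delta)
    finally have c: "?c (\<alpha>(idx l := Suc (\<alpha> (idx l)))) = ?c \<alpha> * (norm (a $ idx l))\<^sup>2" .
    have "letter_eval a l * list_eval a w = of_real ((norm (a $ idx l))\<^sup>2) * list_eval a w'"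
      unfolding w letter_eval_bar[symmetric] by (simp add: list_eval_def mult.assoc)
    moreover have "nf (l # ls) = (\<alpha>(idx l := Suc (\<alpha> (idx l))), w')" using n' w by simp
    ultimately show ?thesis unfolding e using c by (simp add: mult.assoc)
  next
    case False
    then have "nf_cons l (\<alpha>, w) = (\<alpha>, l # w)" by (cases w) auto
    then show ?thesis unfolding e n' by (simp add: list_eval_def)
  qed
qed

lift_definition word_eval :: "quat ^ 'n \<Rightarrow> 'n::finite word \<Rightarrow> quat" is list_eval
proof -
  fix a :: "quat ^ 'n" and u v :: "'n letter list"
  assume "nf u = nf v"
  then show "list_eval a u = list_eval a v"
    using list_eval_nf[of a u] list_eval_nf[of a v] by (simp only:)
qed

lemma word_eval_simps [simp]:
  "word_eval a 1 = 1" "word_eval a (u * v) = word_eval a u * word_eval a v"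
  by (transfer; simp add: list_eval_def)+

lemma word_eval_star: "word_eval a (word_star w) = qcnj (word_eval a w)"
proof (transfer)
  fix a :: "quat ^ 'a::finite" and ls :: "'a letter list"
  have "letter_eval a (bar l) = qcnj (letter_eval a l)" for l by (cases l) auto
  then show "list_eval a (list_star ls) = qcnj (list_eval a ls)"
    by (induction ls) (auto simp: list_eval_def list_star_def)
qed

definition cyc_equiv :: "'n word \<Rightarrow> 'n word \<Rightarrow> bool" where
  "cyc_equiv u v \<longleftrightarrow> (\<exists>w1 w2. u = w1 * w2 \<and> v = w2 * w1)"


section \<open>The free product of the quaternions with the word algebra\<close>

text \<open>
  The coproduct, in unital associative real algebras, of the quaternions and of the real monoid
  algebra of words. It is presented by generators \<open>TConst h\<close> (\<open>h\<close> a quaternion) and \<open>TWord w\<close>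
  (\<open>w\<close> a word): the ring axioms, the relations holding between constants, those holding between
  words, and centrality of the real constants (which makes scalar multiplication bilinear).
\<close>

datatype 'n hterm =
  TConst quat | TWord "'n word" | TAdd "'n hterm" "'n hterm" | TMul "'n hterm" "'n hterm"

inductive heq :: "'n hterm \<Rightarrow> 'n hterm \<Rightarrow> bool" where
  refl: "heq x x"
| sym: "heq x y \<Longrightarrow> heq y x"
| trans: "heq x y \<Longrightarrow> heq y z \<Longrightarrow> heq x z"
| add_cong: "heq x x' \<Longrightarrow> heq y y' \<Longrightarrow> heq (TAdd x y) (TAdd x' y')"
| mul_cong: "heq x x' \<Longrightarrow> heq y y' \<Longrightarrow> heq (TMul x y) (TMul x' y')"
| add_assoc: "heq (TAdd (TAdd x y) z) (TAdd x (TAdd y z))"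
| add_commute: "heq (TAdd x y) (TAdd y x)"
| add_zero: "heq (TAdd (TConst 0) x) x"
| add_neg: "heq (TAdd (TMul (TConst (- 1)) x) x) (TConst 0)"
| mul_assoc: "heq (TMul (TMul x y) z) (TMul x (TMul y z))"
| one_mul: "heq (TMul (TConst 1) x) x"
| mul_one: "heq (TMul x (TConst 1)) x"
| distrib_left: "heq (TMul x (TAdd y z)) (TAdd (TMul x y) (TMul x z))"
| distrib_right: "heq (TMul (TAdd x y) z) (TAdd (TMul x z) (TMul y z))"
| const_add: "heq (TConst (h + k)) (TAdd (TConst h) (TConst k))"
| const_mul: "heq (TConst (h * k)) (TMul (TConst h) (TConst k))"
| word_one: "heq (TWord 1) (TConst 1)"
| word_mul: "heq (TWord (u * v)) (TMul (TWord u) (TWord v))"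
| real_central: "heq (TMul (TConst (of_real r)) x) (TMul x (TConst (of_real r)))"

lemmas heq_axioms =
  heq.refl heq.add_assoc heq.add_commute heq.add_zero heq.add_neg heq.mul_assoc heq.one_mul
  heq.mul_one heq.distrib_left heq.distrib_right heq.const_add heq.const_mul heq.word_one
  heq.word_mul heq.real_central

primrec term_eval :: "('n word \<Rightarrow> quat) \<Rightarrow> 'n hterm \<Rightarrow> quat" where
  "term_eval g (TConst h) = h"
| "term_eval g (TWord w) = g w"
| "term_eval g (TAdd s t) = term_eval g s + term_eval g t"
| "term_eval g (TMul s t) = term_eval g s * term_eval g t"

lemma term_eval_heq:
  assumes "heq s t" "g 1 = 1" "\<And>u v. g (u * v) = g u * g v"
  shows "term_eval g s = term_eval g t"
  using assms(1)
  by induction (auto simp: assms(2,3) algebra_simps of_real_def)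

primrec term_star :: "'n hterm \<Rightarrow> 'n hterm" where
  "term_star (TConst h) = TConst (qcnj h)"
| "term_star (TWord w) = TWord (word_star w)"
| "term_star (TAdd s t) = TAdd (term_star s) (term_star t)"
| "term_star (TMul s t) = TMul (term_star t) (term_star s)"

lemma heq_neg_central: "heq (TMul x (TConst (- 1))) (TMul (TConst (- 1)) x)"
  using heq.sym[OF heq.real_central[of "- 1" x]] by simp

lemma term_star_heq: "heq s t \<Longrightarrow> heq (term_star s) (term_star t)"
proof (induction rule: heq.induct)
  case (sym x y)
  then show ?case by (blast intro: heq.sym)
next
  case (trans x y z)
  then show ?case by (blast intro: heq.trans)
next
  case (add_neg x)
  have *: "qcnj (- 1) = - 1" by (simp add: quat_eq_iff)
  show ?case
    by (simp add: *, rule heq.trans[OF heq.add_cong[OF heq_neg_central heq.refl] heq.add_neg])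
next
  case (mul_assoc x y z)
  show ?case by (simp add: heq.sym[OF heq.mul_assoc])
next
  case (real_central r x)
  show ?case by (simp add: heq.sym[OF heq.real_central])
next
  case (const_add h k)
  show ?case by (simp add: heq.const_add)
qed (simp_all add: heq_axioms heq.add_cong heq.mul_cong)

quotient_type 'n hfree = "'n hterm" / heq
  by (rule equivpI) (auto simp: reflp_def symp_def transp_def intro: heq.refl heq.sym heq.trans)

lift_definition hconst :: "quat \<Rightarrow> 'n hfree" is TConst .
lift_definition hword :: "'n word \<Rightarrow> 'n hfree" is TWord .

instantiation hfree :: (type) ring_1
begin

lift_definition zero_hfree :: "'a hfree" is "TConst 0" .
lift_definition one_hfree :: "'a hfree" is "TConst 1" .
lift_definition plus_hfree :: "'a hfree \<Rightarrow> 'a hfree \<Rightarrow> 'a hfree" is TAdd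
  by (rule heq.add_cong)
lift_definition times_hfree :: "'a hfree \<Rightarrow> 'a hfree \<Rightarrow> 'a hfree" is TMul
  by (rule heq.mul_cong)
lift_definition uminus_hfree :: "'a hfree \<Rightarrow> 'a hfree" is "TMul (TConst (- 1))"
  by (rule heq.mul_cong[OF heq.refl])
definition minus_hfree :: "'a hfree \<Rightarrow> 'a hfree \<Rightarrow> 'a hfree" where
  "x - y = x + (- y :: 'a hfree)"

instance
proof
  show "(0 :: 'a hfree) \<noteq> 1"
  proof (transfer, rule notI)
    assume "heq (TConst 0 :: 'a hterm) (TConst 1)"
    from term_eval_heq[OF this, of "\<lambda>_. 1"] show False by simp
  qed
qed (unfold minus_hfree_def, (transfer; rule heq_axioms)+)

end

lemma hconst_simps [simp]: "hconst 0 = 0" "hconst 1 = 1"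
  by (transfer; rule heq.refl)+

lemma hconst_add: "hconst (h + k) = hconst h + hconst k"
  by transfer (rule heq.const_add)

lemma hconst_mult: "hconst (h * k) = hconst h * hconst k"
  by transfer (rule heq.const_mul)

lemma hconst_central: "hconst (of_real r) * x = x * hconst (of_real r)"
  by transfer (rule heq.real_central)

lemma hword_one [simp]: "hword 1 = 1"
  by transfer (rule heq.word_one)

lemma hword_mult: "hword (u * v) = hword u * hword v"
  by transfer (rule heq.word_mul)

instantiation hfree :: (type) real_algebra_1
begin

definition scaleR_hfree :: "real \<Rightarrow> 'a hfree \<Rightarrow> 'a hfree" where
  "scaleR r x = hconst (of_real r) * x"

instance
proof
  fix a b :: real and x y :: "'a hfree"
  show "a *\<^sub>R x * y = a *\<^sub>R (x * y)"
    by (simp add: scaleR_hfree_def mult.assoc)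
  show "x * a *\<^sub>R y = a *\<^sub>R (x * y)"
    by (simp only: scaleR_hfree_def mult.assoc[symmetric] hconst_central[of a x])
qed (simp_all add: scaleR_hfree_def algebra_simps hconst_add hconst_mult)

end

lift_definition hstar :: "'n hfree \<Rightarrow> 'n hfree" is term_star
  by (rule term_star_heq)

lemma hstar_simps [simp]:
  "hstar (hconst h) = hconst (qcnj h)" "hstar (hword w) = hword (word_star w)"
  "hstar (x + y) = hstar x + hstar y" "hstar (x * y) = hstar y * hstar x"
  by (transfer; simp add: heq.refl)+

lift_definition heval :: "quat ^ 'n \<Rightarrow> 'n::finite hfree \<Rightarrow> quat" is "\<lambda>a. term_eval (word_eval a)"
  by (rule term_eval_heq) auto

lemma heval_simps [simp]:
  "heval a (hconst h) = h" "heval a (hword w) = word_eval a w"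
  "heval a (x + y) = heval a x + heval a y" "heval a (x * y) = heval a x * heval a y"
  by (transfer; simp)+


section \<open>The space P of polynomials and its functionals\<close>

definition poly_of :: "('n word \<times> 'n word \<Rightarrow>\<^sub>0 quat) \<Rightarrow> 'n hfree" where
  "poly_of c = (\<Sum>(a, b)\<in>Poly_Mapping.keys c. hword a * hconst (Poly_Mapping.lookup c (a, b)) * hword b)"

definition polyP :: "'n hfree set" where
  "polyP = range poly_of"

lemma hstar_zero [simp]: "hstar 0 = 0"
  by transfer (simp add: heq.refl)

lemma hstar_sum: "hstar (sum f A) = (\<Sum>x\<in>A. hstar (f x))"
  by (induction A rule: infinite_finite_induct) simp_all

lemma hstar_poly_of: "hstar (poly_of c) =
    (\<Sum>(a, b)\<in>Poly_Mapping.keys c.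
      hword (word_star b) * hconst (qcnj (Poly_Mapping.lookup c (a, b))) * hword (word_star a))"
  by (simp add: poly_of_def hstar_sum case_prod_unfold mult.assoc)

definition symP :: "'n hfree set" where
  "symP = {p \<in> polyP. hstar p = p}"

text \<open>
  \<open>\<real>\<^sub>\<ge>\<^sub>0\<close> is the set of nonnegative reals inside the quaternions.
\<close>

definition nonneg_polys :: "(quat ^ 'n::finite) set \<Rightarrow> 'n hfree set" where
  "nonneg_polys K = {p \<in> symP. \<forall>a\<in>K. heval a p \<in> \<real>\<^sub>\<ge>\<^sub>0}"

definition pseudo_moment :: "('n word \<Rightarrow> quat) \<Rightarrow> bool" where
  "pseudo_moment y \<longleftrightarrow>
     (\<forall>w. y w = qcnj (y (word_star w))) \<and> (\<forall>u v. cyc_equiv u v \<longrightarrow> qRe (y u) = qRe (y v))"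

text \<open>
  The coefficients of an element of \<open>polyP\<close> are not unique (\<open>a r b = (a b) r 1\<close> for real \<open>r\<close>);
  the value below does not depend on them when \<open>y\<close> is a pseudo-moment sequence, see
  \<open>L_R_poly_of\<close>.
\<close>

definition L_R :: "('n word \<Rightarrow> quat) \<Rightarrow> 'n hfree \<Rightarrow> real" where
  "L_R y p = (THE r. \<exists>c. p = poly_of c \<and>
     r = qRe (\<Sum>(a, b)\<in>Poly_Mapping.keys c. Poly_Mapping.lookup c (a, b) * y (b * a)))"

text \<open>
  Well-definedness. Every term acts in two ways on functions of two words (from the left on either
  variable), and \<open>\<delta>\<close> is the derivation between the two actions that vanishes on words and is the
  commutator with the real part on constants. On \<open>a h b\<close> the first action only sees \<open>a b\<close> and \<open>h\<close>,
  while \<open>\<delta>\<close> sees the imaginary part of \<open>h\<close> and the pair \<open>(a, b)\<close>.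
\<close>

primrec actL :: "'n hterm \<Rightarrow> ('n word \<Rightarrow> 'n word \<Rightarrow> quat) \<Rightarrow> 'n word \<Rightarrow> 'n word \<Rightarrow> quat" where
  "actL (TConst h) f = (\<lambda>u v. h * f u v)"
| "actL (TWord w) f = (\<lambda>u v. f (u * w) v)"
| "actL (TAdd s t) f = (\<lambda>u v. actL s f u v + actL t f u v)"
| "actL (TMul s t) f = actL s (actL t f)"

primrec actR :: "'n hterm \<Rightarrow> ('n word \<Rightarrow> 'n word \<Rightarrow> quat) \<Rightarrow> 'n word \<Rightarrow> 'n word \<Rightarrow> quat" where
  "actR (TConst h) f = (\<lambda>u v. h * f u v)"
| "actR (TWord w) f = (\<lambda>u v. f u (v * w))"
| "actR (TAdd s t) f = (\<lambda>u v. actR s f u v + actR t f u v)"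
| "actR (TMul s t) f = actR s (actR t f)"

primrec \<delta> :: "'n hterm \<Rightarrow> ('n word \<Rightarrow> 'n word \<Rightarrow> quat) \<Rightarrow> 'n word \<Rightarrow> 'n word \<Rightarrow> quat" where
  "\<delta> (TConst h) f = (\<lambda>u v. h * of_real (qRe (f u v)) - of_real (qRe (h * f u v)))"
| "\<delta> (TWord w) f = (\<lambda>u v. 0)"
| "\<delta> (TAdd s t) f = (\<lambda>u v. \<delta> s f u v + \<delta> t f u v)"
| "\<delta> (TMul s t) f = (\<lambda>u v. actL s (\<delta> t f) u v + \<delta> s (actR t f) u v)"

lemma actL_linear:
  "actL t (\<lambda>u v. f u v + g u v) = (\<lambda>u v. actL t f u v + actL t g u v)"
  "actL t (\<lambda>u v. of_real r * f u v) = (\<lambda>u v. of_real r * actL t f u v)"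
  by (induction t arbitrary: f g) (auto simp: algebra_simps of_real_def)

lemma actR_linear:
  "actR t (\<lambda>u v. f u v + g u v) = (\<lambda>u v. actR t f u v + actR t g u v)"
  "actR t (\<lambda>u v. of_real r * f u v) = (\<lambda>u v. of_real r * actR t f u v)"
  by (induction t arbitrary: f g) (auto simp: algebra_simps of_real_def)

lemma \<delta>_linear:
  "\<delta> t (\<lambda>u v. f u v + g u v) = (\<lambda>u v. \<delta> t f u v + \<delta> t g u v)"
  "\<delta> t (\<lambda>u v. of_real r * f u v) = (\<lambda>u v. of_real r * \<delta> t f u v)"
proof (induction t arbitrary: f g)
  case (TConst h)
  {
    case 1
    show ?case by (simp add: fun_eq_iff quat_eq_iff algebra_simps)
  next
    case 2
    show ?case by (simp add: fun_eq_iff quat_eq_iff algebra_simps)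
  }
qed (simp_all add: actL_linear actR_linear algebra_simps)

lemma actL_zero: "actL t (\<lambda>u v. 0) = (\<lambda>u v. 0)"
  using actL_linear(2)[of t 0 "\<lambda>u v. 0"] by simp

lemma acts_heq: "heq s t \<Longrightarrow> actL s = actL t \<and> actR s = actR t \<and> \<delta> s = \<delta> t"
proof (induction rule: heq.induct)
  case (mul_cong x x' y y')
  then show ?case by (intro conjI ext) simp_all
next
  case (real_central r x)
  show ?case
    by (auto simp: fun_eq_iff actL_linear actR_linear \<delta>_linear actL_zero)
qed (auto simp: fun_eq_iff actL_linear actR_linear \<delta>_linear actL_zero algebra_simps of_real_def)

lift_definition hL :: "('n word \<Rightarrow> quat) \<Rightarrow> 'n hfree \<Rightarrow> real" is
  "\<lambda>y t. qRe (actL t (\<lambda>u v. of_real (qRe (y u))) 1 1) - qRe (\<delta> t (\<lambda>u v. y (v * u)) 1 1)"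
  by (auto dest: acts_heq)

lemma hL_add: "hL y (p + q) = hL y p + hL y q"
  by transfer simp

lemma hL_zero: "hL y 0 = 0"
  by transfer simp

lemma hL_sum: "hL y (sum f A) = (\<Sum>x\<in>A. hL y (f x))"
  by (induction A rule: infinite_finite_induct) (simp_all add: hL_add hL_zero)

lemma hL_monomial:
  assumes "pseudo_moment y"
  shows "hL y (hword a * hconst h * hword b) = qRe (h * y (b * a))"
proof -
  have "qRe (y (a * b)) = qRe (y (b * a))"
    using assms unfolding pseudo_moment_def cyc_equiv_def by blast
  then show ?thesis
    by transfer (simp add: actL_zero)
qed

lemma qRe_sum: "qRe (sum f A) = (\<Sum>x\<in>A. qRe (f x))"
  by (induction A rule: infinite_finite_induct) simp_all

lemma L_R_poly_of:
  assumes "pseudo_moment y"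
  shows "L_R y (poly_of c) =
    qRe (\<Sum>(a, b)\<in>Poly_Mapping.keys c. Poly_Mapping.lookup c (a, b) * y (b * a))"
proof -
  have hL: "hL y (poly_of c) =
      qRe (\<Sum>(a, b)\<in>Poly_Mapping.keys c. Poly_Mapping.lookup c (a, b) * y (b * a))" for c
    unfolding poly_of_def hL_sum qRe_sum case_prod_unfold hL_monomial[OF assms] ..
  show ?thesis
    unfolding L_R_def
  proof (rule the_equality, goal_cases)
    case 1
    then show ?case by blast
  next
    case (2 r)
    then obtain c' where c': "poly_of c = poly_of c'"
      "r = qRe (\<Sum>(a, b)\<in>Poly_Mapping.keys c'. Poly_Mapping.lookup c' (a, b) * y (b * a))"
      by blast
    then show ?case unfolding hL[symmetric] by simp
  qed
qed

text \<open>
  A Borel measure on \<open>K\<close> is a measure on the trace of the Borel sets on \<open>K\<close>. Bochner integrability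
  of a quaternion-valued function is integrability of its four real components.
\<close>

definition representing_measure ::
    "(quat ^ 'n::finite) set \<Rightarrow> ('n word \<Rightarrow> quat) \<Rightarrow> (quat ^ 'n) measure \<Rightarrow> bool" where
  "representing_measure K y \<mu> \<longleftrightarrow>
     sets \<mu> = sets (restrict_space borel K) \<and>
     (\<forall>w. integrable \<mu> (\<lambda>a. word_eval a w) \<and> y w = (\<integral>a. word_eval a w \<partial>\<mu>))"

end

(*
  Only the real components of word evaluations are controlled by y; they span a proper subspace V of
  the real polynomials in 4n variables that is not closed under products, so the Riesz-Haviland
  theorem does not apply directly. But V is an adapted space in the sense of Choquet: the powers of
  1 + |q_1|^2 + ... + |q_n|^2 lie in V, and every element of V is o() of one of them. The functional
  on V is therefore dominated by a sublinear functional on all bounded functions, and Hahn-Banach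
  yields a positive functional on all bounded functions. Its values on indicators make a measure out
  of it: after compactifying the space and coding the compactification by real numbers with a
  continuous decoding map, the measure is the image of a Lebesgue-Stieltjes measure on the line.
  The growth condition then recovers the functional on V from the integrals of cut-off functions, and
  V contains every real component of every word.
*)
theory Submission
  imports Defs
begin

text \<open>The Hahn-Banach step uses all bounded functions, not just continuous ones, because the
  code of a point need not depend continuously on it: the distribution function consists of the
  values of the functional on indicators of half-lines composed with the code. The functional so
  obtained is only finitely additive. Its distribution function therefore has to be regularised from
  the right, and mass may escape to infinity; continuous functions of bounded support see neither
  defect. The functional does not extend the given one, as elements of V are in general unbounded.
  Domination alone links the two: if v majorises (1 + |a|) |p| on K, cutting p off at radius R costs
  at most v / (R + 1), so the values on the cut-off functions tend to the given value at p. That the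
  measure lives on K is a separate step: test functions built from the distance to the closed set K
  have integral 0. The component of a word w along a quaternion h comes from V because w h' + h w*,
  with h' the conjugate of h, is symmetric and evaluates to twice that component.\<close>

section \<open>Positive functionals on bounded functions\<close>

definition sublinear_on :: "('a \<Rightarrow> real) set \<Rightarrow> (('a \<Rightarrow> real) \<Rightarrow> real) \<Rightarrow> bool" where
  "sublinear_on E q \<longleftrightarrow>
     (\<forall>f\<in>E. \<forall>g\<in>E. q (\<lambda>x. f x + g x) \<le> q f + q g) \<and>
     (\<forall>f\<in>E. \<forall>c>0. q (\<lambda>x. c * f x) \<le> c * q f)"

locale function_space =
  fixes E :: "('a \<Rightarrow> real) set"
  assumes zero_mem: "(\<lambda>_. 0) \<in> E"
    and add_mem: "f \<in> E \<Longrightarrow> g \<in> E \<Longrightarrow> (\<lambda>x. f x + g x) \<in> E"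
    and scale_mem: "f \<in> E \<Longrightarrow> (\<lambda>x. c * f x) \<in> E"
begin

lemma sublinear_add: "sublinear_on E q \<Longrightarrow> f \<in> E \<Longrightarrow> g \<in> E \<Longrightarrow> q (\<lambda>x. f x + g x) \<le> q f + q g"
  and sublinear_scale_le: "sublinear_on E q \<Longrightarrow> f \<in> E \<Longrightarrow> 0 < c \<Longrightarrow> q (\<lambda>x. c * f x) \<le> c * q f"
  unfolding sublinear_on_def by auto

lemma uminus_mem: "f \<in> E \<Longrightarrow> (\<lambda>x. - f x) \<in> E"
  using scale_mem[of f "- 1"] by simp

lemma sublinear_zero:
  assumes "sublinear_on E q"
  shows "q (\<lambda>_. 0) = 0"
proof -
  \<comment> \<open>Subadditivity at 0 + 0 makes the value at 0 nonnegative, and scaling by 1/2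
    makes it nonpositive.\<close>
  show ?thesis
    using sublinear_add[OF assms zero_mem zero_mem] sublinear_scale_le[OF assms zero_mem, of "1/2"]
    by simp
qed

lemma sublinear_uminus:
  assumes "sublinear_on E q" "f \<in> E"
  shows "- q (\<lambda>x. - f x) \<le> q f"
proof -
  have "q (\<lambda>x. f x + - f x) \<le> q f + q (\<lambda>x. - f x)"
    by (rule sublinear_add[OF assms uminus_mem[OF assms(2)]])
  then show ?thesis using sublinear_zero[OF assms(1)] by simp
qed

text \<open>The inequality for \<open>inverse c\<close>, applied to \<open>c f\<close>, reverses the
  one for \<open>c\<close>. This is why \<open>sublinear_on\<close> asks for one direction only,
  which is easier to verify for infima.\<close>

lemma sublinear_scale:
  assumes "sublinear_on E q" "f \<in> E" "0 \<le> c"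
  shows "q (\<lambda>x. c * f x) = c * q f"
proof (cases "c = 0")
  case True
  then show ?thesis using sublinear_zero[OF assms(1)] by simp
next
  case False
  with assms have "q (\<lambda>x. c * f x) \<le> c * q f"
    unfolding sublinear_on_def by simp
  moreover have "q (\<lambda>x. inverse c * (c * f x)) \<le> inverse c * q (\<lambda>x. c * f x)"
    using assms False scale_mem unfolding sublinear_on_def by simp
  then have "c * q f \<le> q (\<lambda>x. c * f x)"
    using assms(3) False by (simp add: field_simps)
  ultimately show ?thesis by simp
qed

text \<open>
  A pointwise minimal sublinear functional \<open>q\<close> is linear: for \<open>h\<close> in \<open>E\<close>, the sublinear functional
  \<open>g \<mapsto> inf\<^sub>t (q (g + t h) - t q h)\<close> lies below \<open>q\<close>, hence equals it, and \<open>t = 1\<close> gives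
  \<open>q g + q h \<le> q (g + h)\<close>.
\<close>

lemma minimal_sublinear_additive:
  assumes q: "sublinear_on E q" and out: "\<And>f. f \<notin> E \<Longrightarrow> q f = 0"
    and minimal: "\<And>q'. sublinear_on E q' \<Longrightarrow> (\<And>f. f \<notin> E \<Longrightarrow> q' f = 0) \<Longrightarrow> q' \<le> q \<Longrightarrow> q' = q"
    and g: "g \<in> E" and h: "h \<in> E"
  shows "q (\<lambda>x. g x + h x) = q g + q h"
proof -
  define r where "r g t = q (\<lambda>x. g x + t * h x) - t * q h" for g t
  define q' where "q' g = (if g \<in> E then Inf (r g ` {0..}) else 0)" for g
  \<comment> \<open>Makes the infimum over \<open>t\<close> finite: writing \<open>t h\<close> as
    \<open>(g + t h) + (- g)\<close> bounds \<open>t * q h\<close> from above.\<close>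
  have bound: "- q (\<lambda>x. - g x) \<le> r g t" if "g \<in> E" "t \<in> {0..}" for g t
  proof -
    have "q (\<lambda>x. (g x + t * h x) + - g x) \<le> q (\<lambda>x. g x + t * h x) + q (\<lambda>x. - g x)"
      using that(1) h by (intro sublinear_add[OF q] add_mem scale_mem uminus_mem)
    then show ?thesis using sublinear_scale[OF q h, of t] that(2) by (simp add: r_def)
  qed
  have lower: "q' g \<le> r g t" if "g \<in> E" "0 \<le> t" for g t
    using that bound[OF that(1)] unfolding q'_def by (auto intro!: cInf_lower bdd_belowI2)
  have greatest: "c \<le> q' g" if "g \<in> E" "\<And>t. 0 \<le> t \<Longrightarrow> c \<le> r g t" for g c
    using that unfolding q'_def by (auto intro!: cInf_greatest)
  have "sublinear_on E q'"
    unfolding sublinear_on_def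
  proof (intro conjI ballI allI impI)
    fix g1 g2 assume E: "g1 \<in> E" "g2 \<in> E"
    have "q' (\<lambda>x. g1 x + g2 x) - r g2 t2 \<le> r g1 t1" if "0 \<le> t1" "0 \<le> t2" for t1 t2
    proof -
      \<comment> \<open>At the parameter \<open>t1 + t2\<close> the perturbed functions
        \<open>g1 + t1 h\<close> and \<open>g2 + t2 h\<close> add up exactly.\<close>
      have "q' (\<lambda>x. g1 x + g2 x) \<le> r (\<lambda>x. g1 x + g2 x) (t1 + t2)"
        using E that by (intro lower add_mem) auto
      moreover have "q (\<lambda>x. (g1 x + t1 * h x) + (g2 x + t2 * h x)) \<le>
          q (\<lambda>x. g1 x + t1 * h x) + q (\<lambda>x. g2 x + t2 * h x)"
        using E h by (intro sublinear_add[OF q] add_mem scale_mem)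
      ultimately show ?thesis by (simp add: r_def algebra_simps)
    qed
    then have "q' (\<lambda>x. g1 x + g2 x) - r g2 t2 \<le> q' g1" if "0 \<le> t2" for t2
      using that by (intro greatest[OF E(1)]) auto
    then have "q' (\<lambda>x. g1 x + g2 x) - q' g1 \<le> q' g2"
      by (intro greatest[OF E(2)]) (simp add: algebra_simps)
    then show "q' (\<lambda>x. g1 x + g2 x) \<le> q' g1 + q' g2" by simp
  next
    fix g and c :: real assume E: "g \<in> E" and c: "0 < c"
    have "inverse c * q' (\<lambda>x. c * g x) \<le> r g t" if t: "0 \<le> t" for t
    proof -
      have "q' (\<lambda>x. c * g x) \<le> r (\<lambda>x. c * g x) (c * t)"
        using E c t by (intro lower scale_mem) auto
      also have "\<dots> = c * r g t"
        using sublinear_scale[OF q add_mem[OF E scale_mem[OF h]], of c t] c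
        by (simp add: r_def algebra_simps)
      finally show ?thesis using c by (simp add: field_simps)
    qed
    then have "inverse c * q' (\<lambda>x. c * g x) \<le> q' g" by (rule greatest[OF E])
    then show "q' (\<lambda>x. c * g x) \<le> c * q' g" using c by (simp add: field_simps)
  qed
  moreover have "q' \<le> q"
  proof (rule le_funI)
    show "q' g \<le> q g" for g
      using lower[of g 0] out by (cases "g \<in> E") (auto simp: q'_def r_def)
  qed
  ultimately have "q' = q" by (intro minimal) (auto simp: q'_def)
  then have "q g \<le> r g 1" using lower[OF g, of 1] by simp
  moreover have "q (\<lambda>x. g x + h x) \<le> q g + q h"
    by (rule sublinear_add[OF q g h])
  ultimately show ?thesis by (simp add: r_def)
qed

text \<open>Lower bounds of chains for Zorn's lemma. The common majorant \<open>p\<close> keeps the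
  infimum finite, since \<open>- p (- f) \<le> - q (- f) \<le> q f\<close>. Subadditivity needs the
  chain: of two members, the smaller one lies below both.\<close>

lemma sublinear_Inf:
  assumes "C \<noteq> {}" and sub: "\<And>q. q \<in> C \<Longrightarrow> sublinear_on E q \<and> q \<le> p"
    and chain: "\<And>q1 q2. q1 \<in> C \<Longrightarrow> q2 \<in> C \<Longrightarrow> q1 \<le> q2 \<or> q2 \<le> q1"
  defines "u \<equiv> \<lambda>f. if f \<in> E then (INF q\<in>C. q f) else (0 :: real)"
  shows "sublinear_on E u" and "q \<in> C \<Longrightarrow> f \<in> E \<Longrightarrow> u f \<le> q f"
proof -
  have lower: "u f \<le> q f" if "q \<in> C" "f \<in> E" for q f
  proof -
    have "- p (\<lambda>x. - f x) \<le> q f" if "q \<in> C" for q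
      using sublinear_uminus[of q f] sub[OF that] le_funD[of q p "\<lambda>x. - f x"] \<open>f \<in> E\<close> by fastforce
    then show ?thesis using that unfolding u_def by (auto intro!: cINF_lower bdd_belowI2)
  qed
  then show "q \<in> C \<Longrightarrow> f \<in> E \<Longrightarrow> u f \<le> q f" .
  have greatest: "c \<le> u f" if "f \<in> E" "\<And>q. q \<in> C \<Longrightarrow> c \<le> q f" for f c
    using that \<open>C \<noteq> {}\<close> unfolding u_def by (auto intro!: cINF_greatest)
  show "sublinear_on E u"
    unfolding sublinear_on_def
  proof (intro conjI ballI allI impI)
    fix f g assume E: "f \<in> E" "g \<in> E"
    have "u (\<lambda>x. f x + g x) - q2 g \<le> q1 f" if q12: "q1 \<in> C" "q2 \<in> C" for q1 q2
    proof -
      obtain q where q: "q \<in> C" "q \<le> q1" "q \<le> q2" using chain[OF q12] q12 by blast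
      have "u (\<lambda>x. f x + g x) \<le> q (\<lambda>x. f x + g x)" using lower q(1) add_mem[OF E] by blast
      also have "\<dots> \<le> q f + q g" using sub[OF q(1)] E by (intro sublinear_add) auto
      also have "\<dots> \<le> q1 f + q2 g" using le_funD[OF q(2), of f] le_funD[OF q(3), of g] by simp
      finally show ?thesis by simp
    qed
    then have "u (\<lambda>x. f x + g x) - q2 g \<le> u f" if "q2 \<in> C" for q2
      using that by (intro greatest E)
    then have "u (\<lambda>x. f x + g x) - u f \<le> u g"
      by (intro greatest E) (simp add: algebra_simps)
    then show "u (\<lambda>x. f x + g x) \<le> u f + u g" by simp
  next
    fix f and c :: real assume E: "f \<in> E" and c: "0 < c"
    have "inverse c * u (\<lambda>x. c * f x) \<le> q f" if "q \<in> C" for q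
    proof -
      have "u (\<lambda>x. c * f x) \<le> q (\<lambda>x. c * f x)" using lower that scale_mem[OF E] by blast
      also have "\<dots> \<le> c * q f" using sub[OF that] E c by (intro sublinear_scale_le) auto
      finally show ?thesis using c by (simp add: field_simps)
    qed
    then have "inverse c * u (\<lambda>x. c * f x) \<le> u f" by (rule greatest[OF E])
    then show "u (\<lambda>x. c * f x) \<le> c * u f" using c by (simp add: field_simps)
  qed
qed

text \<open>Hahn-Banach without partial extensions: Zorn's lemma is applied to the sublinear
  functionals below \<open>p\<close>, and a minimal one is already linear.\<close>

lemma sublinear_dominates_linear:
  assumes p: "sublinear_on E p"
  obtains \<Lambda> where
    "\<And>f g. f \<in> E \<Longrightarrow> g \<in> E \<Longrightarrow> \<Lambda> (\<lambda>x. f x + g x) = \<Lambda> f + \<Lambda> g"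
    "\<And>f c. f \<in> E \<Longrightarrow> \<Lambda> (\<lambda>x. c * f x) = c * \<Lambda> f"
    "\<And>f. f \<in> E \<Longrightarrow> \<Lambda> f \<le> p f"
proof -
  \<comment> \<open>All candidates are 0 outside \<open>E\<close>, so that comparing them pointwise
    compares them on \<open>E\<close> and minimality yields equality of functions.\<close>
  define p0 where "p0 f = (if f \<in> E then p f else 0)" for f
  have p0: "sublinear_on E p0"
    using p add_mem scale_mem unfolding sublinear_on_def p0_def by simp
  define A where "A = {q. sublinear_on E q \<and> (\<forall>f. f \<notin> E \<longrightarrow> q f = 0) \<and> q \<le> p0}"
  have "\<exists>q\<in>A. \<forall>q'\<in>A. q' \<le> q \<longrightarrow> q' = q"
  \<comment> \<open>The relation is the reversed order, so upper bounds of chains are infima and a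
    maximal element is a minimal functional.\<close>
  proof (rule predicate_Zorn)
    show "partial_order_on A (relation_of (\<lambda>q q'. q' \<le> q) A)"
      by (auto intro!: partial_order_on_relation_ofI)
  next
    fix C assume "C \<in> Chains (relation_of (\<lambda>q q'. q' \<le> q) A)"
    then have chain: "q1 \<le> q2 \<or> q2 \<le> q1" if "q1 \<in> C" "q2 \<in> C" for q1 q2
      using that unfolding Chains_def relation_of_def by blast
    have CA: "q \<in> A" if "q \<in> C" for q
      using \<open>C \<in> Chains _\<close> that unfolding Chains_def relation_of_def by blast
    show "\<exists>u\<in>A. \<forall>q\<in>C. u \<le> q"
    proof (cases "C = {}")
      case True
      have "p0 \<in> A" using p0 by (auto simp: A_def p0_def)
      then show ?thesis using True by blast
    next
      case False
      define u where "u f = (if f \<in> E then (INF q\<in>C. q f) else 0)" for f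
      have sub: "sublinear_on E q \<and> q \<le> p0" if "q \<in> C" for q
        using CA[OF that] by (simp add: A_def)
      have uC: "u f \<le> q f" if "q \<in> C" "f \<in> E" for q f
        unfolding u_def by (rule sublinear_Inf(2)[where p = p0]) (use False sub chain that in auto)
      have uq: "u \<le> q" if "q \<in> C" for q
      proof (rule le_funI)
        show "u f \<le> q f" for f
          using uC[OF that, of f] CA[OF that] by (cases "f \<in> E") (auto simp: u_def A_def)
      qed
      obtain q where "q \<in> C" using False by blast
      then have "u \<le> p0" using uq sub order.trans by blast
      moreover have "sublinear_on E u"
        unfolding u_def by (rule sublinear_Inf(1)[where p = p0]) (use False sub chain in auto)
      ultimately have "u \<in> A" by (simp add: A_def u_def)
      then show ?thesis using uq by blast
    qed
  qed
  then obtain q where q: "q \<in> A" and min: "\<And>q'. q' \<in> A \<Longrightarrow> q' \<le> q \<Longrightarrow> q' = q" by blast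
  have sub: "sublinear_on E q" using q by (simp add: A_def)
  have add: "q (\<lambda>x. f x + g x) = q f + q g" if "f \<in> E" "g \<in> E" for f g
  proof (rule minimal_sublinear_additive[OF sub _ _ that])
    show "q f = 0" if "f \<notin> E" for f using q that by (simp add: A_def)
    fix q' assume "sublinear_on E q'" "\<And>f. f \<notin> E \<Longrightarrow> q' f = 0" "q' \<le> q"
    moreover from this have "q' \<le> p0" using q order.trans by (auto simp: A_def)
    ultimately show "q' = q" by (intro min) (auto simp: A_def)
  qed
  have minus: "q (\<lambda>x. - f x) = - q f" if "f \<in> E" for f
    using add[OF that uminus_mem[OF that]] sublinear_zero[OF sub] by simp
  show thesis
  proof (rule that[of q])
    show "q (\<lambda>x. c * f x) = c * q f" if "f \<in> E" for f c
    proof (cases "0 \<le> c")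
      case False
      then have "q (\<lambda>x. - c * f x) = - c * q f" using sublinear_scale[OF sub that, of "- c"] by simp
      then show ?thesis using minus[OF scale_mem[OF that], of "- c"] by simp
    qed (rule sublinear_scale[OF sub that])
    show "q f \<le> p f" if "f \<in> E" for f
      using q that le_funD[of q p0 f] by (simp add: A_def p0_def)
  qed (rule add)
qed

end

section \<open>Finitely additive positive functionals\<close>

locale positive_functional =
  fixes \<Lambda> :: "('a \<Rightarrow> real) \<Rightarrow> real"
  assumes add: "bounded (range f) \<Longrightarrow> bounded (range g) \<Longrightarrow> \<Lambda> (\<lambda>x. f x + g x) = \<Lambda> f + \<Lambda> g"
    and scale: "bounded (range f) \<Longrightarrow> \<Lambda> (\<lambda>x. c * f x) = c * \<Lambda> f"
    and nonneg: "bounded (range f) \<Longrightarrow> (\<And>x. 0 \<le> f x) \<Longrightarrow> 0 \<le> \<Lambda> f"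

lemma bounded_range_real: "bounded (range (f :: 'a \<Rightarrow> real)) \<longleftrightarrow> (\<exists>B. \<forall>x. \<bar>f x\<bar> \<le> B)"
  by (auto simp: bounded_iff)

lemma bounded_range_add:
  "bounded (range f) \<Longrightarrow> bounded (range g) \<Longrightarrow> bounded (range (\<lambda>x. f x + g x :: real))"
  unfolding bounded_range_real by (meson abs_triangle_ineq add_mono order.trans)

lemma bounded_range_scale: "bounded (range f) \<Longrightarrow> bounded (range (\<lambda>x. c * f x :: real))"
  unfolding bounded_range_real by (metis abs_ge_zero abs_mult mult_left_mono)

lemma bounded_range_sum:
  "(\<And>i. i \<in> I \<Longrightarrow> bounded (range (f i))) \<Longrightarrow> bounded (range (\<lambda>x. \<Sum>i\<in>I. f i x :: real))"
  by (induction I rule: infinite_finite_induct) (auto simp: bounded_range_add)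

lemma bounded_range_step: "bounded (range (\<lambda>x. if P x then 1 else 0 :: real))"
  unfolding bounded_range_real by (rule exI[of _ 1]) auto

context positive_functional
begin

lemma zero: "\<Lambda> (\<lambda>_. 0) = 0"
  using scale[of "\<lambda>_. 0" 0] by simp

lemma diff:
  assumes "bounded (range f)" "bounded (range g)"
  shows "\<Lambda> (\<lambda>x. f x - g x) = \<Lambda> f - \<Lambda> g"
  using add[OF assms(1) bounded_range_scale[OF assms(2), of "- 1"]] scale[OF assms(2), of "- 1"]
  by simp

lemma mono:
  assumes "bounded (range f)" "bounded (range g)" "\<And>x. f x \<le> g x"
  shows "\<Lambda> f \<le> \<Lambda> g"
proof -
  have "0 \<le> \<Lambda> (\<lambda>x. g x + (- 1) * f x)"
    using assms by (intro nonneg bounded_range_add bounded_range_scale) auto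
  then show ?thesis using diff[OF assms(2,1)] by simp
qed

lemma sum:
  assumes "\<And>i. i \<in> I \<Longrightarrow> bounded (range (f i))"
  shows "\<Lambda> (\<lambda>x. \<Sum>i\<in>I. f i x) = (\<Sum>i\<in>I. \<Lambda> (f i))"
  using assms
  by (induction I rule: infinite_finite_induct) (auto simp: zero add bounded_range_sum)

lemma abs_diff_le:
  assumes "bounded (range f)" "bounded (range g)" "\<And>x. \<bar>f x - g x\<bar> \<le> c"
  shows "\<bar>\<Lambda> f - \<Lambda> g\<bar> \<le> c * \<Lambda> (\<lambda>_. 1)"
proof -
  have b: "bounded (range (\<lambda>_ :: 'a. 1 :: real))" by (auto simp: bounded_range_real)
  have "\<Lambda> f \<le> \<Lambda> (\<lambda>x. g x + c * 1)" "\<Lambda> g \<le> \<Lambda> (\<lambda>x. f x + c * 1)"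
    using assms b by (auto intro!: mono bounded_range_add bounded_range_scale simp: abs_le_iff)
      (smt (verit))+
  then show ?thesis
    using add[OF assms(1) bounded_range_scale[OF b, of c]]
      add[OF assms(2) bounded_range_scale[OF b, of c]] scale[OF b, of c] by simp
qed

end

section \<open>Functionals that factor through the unit interval\<close>

lemma interval_measure_finite:
  fixes G :: "real \<Rightarrow> real"
  assumes mono: "\<And>s t. s \<le> t \<Longrightarrow> G s \<le> G t" and cont: "\<And>t. continuous (at_right t) G"
    and low: "\<And>t. t < 0 \<Longrightarrow> G t = 0" and high: "\<And>t. 1 \<le> t \<Longrightarrow> G t = M"
  shows "finite_measure (interval_measure G)" "measure (interval_measure G) UNIV = M"
proof -
  let ?\<nu> = "interval_measure G"
  \<comment> \<open>Since \<open>G\<close> is constant to the left of 0 and from 1 on, each of these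
    exhausting intervals already carries the whole increment \<open>M\<close>.\<close>
  have e: "emeasure ?\<nu> {- 1 - real n<..1 + real n} = ennreal M" for n
    using low[of "- 1 - real n"] high[of "1 + real n"]
    by (subst emeasure_interval_measure_Ioc) (auto simp: mono cont)
  have U: "(\<Union>n. {- 1 - real n<..1 + real n}) = (UNIV :: real set)"
  proof (intro set_eqI iffI UNIV_I)
    fix x :: real
    obtain n where "\<bar>x\<bar> < real n" using reals_Archimedean2 by blast
    then show "x \<in> (\<Union>n. {- 1 - real n<..1 + real n})" by (intro UN_I[of n]) auto
  qed
  have "(SUP n. emeasure ?\<nu> {- 1 - real n<..1 + real n}) = emeasure ?\<nu> UNIV"
    unfolding U[symmetric] by (rule SUP_emeasure_incseq) (auto simp: incseq_def)
  then have tot: "emeasure ?\<nu> UNIV = ennreal M" by (simp add: e)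
  then show "finite_measure ?\<nu>" by (intro finite_measureI) simp
  have "0 \<le> M" using mono[of "- 1" 1] low[of "-1"] high[of 1] by simp
  then show "measure ?\<nu> UNIV = M" using tot by (simp add: measure_def)
qed

text \<open>Each of the finitely many nodes rules out only countably many offsets. This places the
  nodes of a partition at continuity points of a monotone function.\<close>

lemma grid_avoiding_countable:
  fixes D :: "real set"
  assumes "countable D"
  obtains a where "- 1 < a" "a < 0" "\<And>i. i \<le> k \<Longrightarrow> a + real i * h \<notin> D"
proof -
  have "countable (\<Union>i\<in>{..k}. (\<lambda>d. d - real i * h) ` D)"
    using assms by (intro countable_UN) auto
  moreover have "uncountable {- 1<..<(0::real)}" by (simp add: uncountable_open_interval)
  ultimately obtain a where a: "a \<in> {- 1<..<0}" "a \<notin> (\<Union>i\<in>{..k}. (\<lambda>d. d - real i * h) ` D)"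
    by (meson countable_subset subsetI)
  show thesis
  proof (rule that[of a])
    fix i assume "i \<le> k"
    show "a + real i * h \<notin> D"
    proof
      assume "a + real i * h \<in> D"
      then have "(a + real i * h) - real i * h \<in> (\<lambda>d. d - real i * h) ` D" by (rule imageI)
      then show False using a(2) \<open>i \<le> k\<close> by auto
    qed
  qed (use a in auto)
qed

context positive_functional
begin

text \<open>\<open>F\<close> is the distribution function of \<open>e\<close> under \<Lambda>.
  Finite additivity does not make it right continuous, so the measure is built from the
  regularisation \<open>G\<close>, which agrees with \<open>F\<close> wherever \<open>F\<close> is
  continuous. A step function with nodes at such points has the same integral as its value under
  \<Lambda>, and such step functions approximate \<phi> uniformly on the values of
  \<open>e\<close>.\<close>

lemma representation_real:
  fixes e :: "'a \<Rightarrow> real"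
  assumes e: "\<And>x. 0 \<le> e x" "\<And>x. e x \<le> 1"
  obtains \<nu> :: "real measure" where "sets \<nu> = sets borel" "finite_measure \<nu>"
    "\<And>\<phi>. continuous_on UNIV \<phi> \<Longrightarrow> bounded (range \<phi>) \<Longrightarrow> (\<integral>t. \<phi> t \<partial>\<nu>) = \<Lambda> (\<lambda>x. \<phi> (e x))"
proof -
  define H :: "real \<Rightarrow> real \<Rightarrow> real" where "H t s = (if s \<le> t then 1 else 0)" for t s
  define F where "F t = \<Lambda> (\<lambda>x. H t (e x))" for t
  define G where "G t = Inf (F ` {t<..})" for t
  define M where "M = \<Lambda> (\<lambda>_. 1)"
  have bH: "bounded (range (\<lambda>x. H t (u x)))" for t and u :: "'b \<Rightarrow> real"
    unfolding H_def by (rule bounded_range_step)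
  have b1: "bounded (range (\<lambda>_ :: 'a. 1 :: real))" by (auto simp: bounded_range_real)
  have F_mono: "F s \<le> F t" if "s \<le> t" for s t
    unfolding F_def using that by (intro mono bH) (auto simp: H_def)
  have F_nonneg: "0 \<le> F t" for t
    unfolding F_def by (intro nonneg bH) (auto simp: H_def)
  have F_low: "F t = 0" if "t < 0" for t
  proof -
    have "H t (e x) = 0" for x using e(1)[of x] that by (simp add: H_def)
    then show ?thesis by (simp add: F_def zero)
  qed
  have F_high: "F t = M" if "1 \<le> t" for t
  proof -
    have "H t (e x) = 1" for x using e(2)[of x] that by (simp add: H_def)
    then show ?thesis by (simp add: F_def M_def)
  qed
  have M: "0 \<le> M" using F_nonneg[of 1] F_high[of 1] by simp
  have G_le: "G t \<le> F s" if "t < s" for s t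
    unfolding G_def using that F_nonneg by (auto intro!: cInf_lower bdd_belowI2)
  have le_G: "c \<le> G t" if "\<And>s. t < s \<Longrightarrow> c \<le> F s" for c t
    unfolding G_def using that by (auto intro!: cInf_greatest)
  have FG: "F t \<le> G t" for t by (rule le_G) (simp add: F_mono)
  have G_mono: "G s \<le> G t" if "s \<le> t" for s t
    using that by (intro le_G G_le) auto
  have G_low: "G t = 0" if "t < 0" for t
    using G_le[of t "t / 2"] FG[of t] F_low[of t] F_low[of "t / 2"] that by simp
  have G_high: "G t = M" if "1 \<le> t" for t
    using G_le[of t "t + 1"] FG[of t] F_high[of t] F_high[of "t + 1"] that by simp
  have G_cont: "continuous (at_right t) G" for t
  proof (subst continuous_at_right_real_increasing)
    show "\<forall>\<epsilon>>0. \<exists>d>0. G (t + d) - G t < \<epsilon>"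
    proof (intro allI impI)
      fix \<epsilon> :: real assume "0 < \<epsilon>"
      then obtain s where s: "t < s" "F s < G t + \<epsilon>"
        using le_G[of t "G t + \<epsilon>"] by force
      have "G (t + (s - t) / 2) \<le> F s" using s by (intro G_le) (simp add: field_simps)
      then show "\<exists>d>0. G (t + d) - G t < \<epsilon>" using s by (intro exI[of _ "(s - t) / 2"]) auto
    qed
  qed (rule G_mono)
  have GF: "G t = F t" if "isCont F t" for t
  proof -
    have "(F \<longlongrightarrow> F t) (at_right t)"
      using that by (auto simp: isCont_def intro: filterlim_at_split[THEN iffD1, THEN conjunct2])
    moreover have "eventually (\<lambda>s. G t \<le> F s) (at_right t)"
      using G_le by (auto simp: eventually_at_filter)
    ultimately have "G t \<le> F t" by (intro tendsto_lowerbound) auto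
    then show ?thesis using FG[of t] by simp
  qed
  define \<nu> where "\<nu> = interval_measure G"
  have \<nu>: "sets \<nu> = sets borel" "space \<nu> = UNIV" by (simp_all add: \<nu>_def)
  have fin: "finite_measure \<nu>" and total: "measure \<nu> UNIV = M"
    unfolding \<nu>_def using interval_measure_finite[of G M] G_mono G_cont G_low G_high by blast+
  interpret \<nu>: finite_measure \<nu> by (rule fin)
  show thesis
  proof (rule that[of \<nu>])
    fix \<phi> :: "real \<Rightarrow> real" assume \<phi>: "continuous_on UNIV \<phi>" "bounded (range \<phi>)"
    have \<phi>m: "\<phi> \<in> borel_measurable \<nu>"
      using borel_measurable_continuous_onI[OF \<phi>(1)] by (simp add: measurable_cong_sets[OF \<nu>(1) HOL.refl])
    obtain B where B: "\<And>t. \<bar>\<phi> t\<bar> \<le> B" using \<phi>(2) unfolding bounded_range_real by blast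
    have \<phi>i: "integrable \<nu> \<phi>" using B \<phi>m by (intro \<nu>.integrable_const_bound[of _ B]) auto
    have b\<phi>: "bounded (range (\<lambda>x. \<phi> (e x)))" using B by (auto simp: bounded_range_real)
    have close: "\<bar>(\<integral>t. \<phi> t \<partial>\<nu>) - \<Lambda> (\<lambda>x. \<phi> (e x))\<bar> \<le> \<epsilon> * M + \<epsilon> * M" if \<epsilon>: "0 < \<epsilon>" for \<epsilon>
    proof -
      have "uniformly_continuous_on {- 1..3} \<phi>"
        using \<phi>(1) by (intro compact_uniformly_continuous continuous_on_subset[OF \<phi>(1)]) auto
      then obtain \<delta> where \<delta>: "0 < \<delta>"
        "\<And>s t. s \<in> {- 1..3} \<Longrightarrow> t \<in> {- 1..3} \<Longrightarrow> dist s t < \<delta> \<Longrightarrow> dist (\<phi> s) (\<phi> t) < \<epsilon>"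
        using \<epsilon> unfolding uniformly_continuous_on_def by (metis (no_types, lifting))
      obtain n where n: "0 < n" "1 / real n < \<delta>"
        using \<delta>(1) reals_Archimedean[of \<delta>] by (metis inverse_eq_divide zero_less_Suc)
      \<comment> \<open>The grid starts in ]-1, 0[ with mesh \<open>1 / n\<close>;
        \<open>2 * n\<close> steps have total length 2, so it ends in ]1, 2[ and covers the values
        of \<open>e\<close>.\<close>
      define k where "k = 2 * n"
      define h where "h = 1 / real n"
      have "countable {t. \<not> isCont F t}" using F_mono by (intro mono_ctble_discont) (simp add: mono_def)
      then obtain a where a: "- 1 < a" "a < 0" "\<And>i. i \<le> k \<Longrightarrow> a + real i * h \<notin> {t. \<not> isCont F t}"
        using grid_avoiding_countable by metis
      define \<tau> where "\<tau> i = a + real i * h" for i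
      have kh: "real k * h = 2" using n by (simp add: k_def h_def)
      have \<tau>0: "- 1 < \<tau> 0" "\<tau> 0 < 0" using a by (auto simp: \<tau>_def)
      have \<tau>k: "1 < \<tau> k" "\<tau> k < 2" using a kh by (auto simp: \<tau>_def)
      have \<tau>_Suc: "\<tau> (Suc i) = \<tau> i + h" for i by (simp add: \<tau>_def algebra_simps)
      have h: "0 < h" "h < \<delta>" using n by (auto simp: h_def)
      have \<tau>_bounds: "- 1 \<le> \<tau> i" "\<tau> i \<le> 3" if "i \<le> k" for i
      proof -
        have "0 \<le> real i * h" "real i * h \<le> real k * h"
          using h that by (auto intro: mult_right_mono)
        then show "- 1 \<le> \<tau> i" "\<tau> i \<le> 3" using a kh by (auto simp: \<tau>_def)
      qed
      \<comment> \<open>The indicator of a cell, written as a difference of half-line indicators so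
        that \<Lambda> of it is an increment of \<open>F\<close>.\<close>
      define J where "J i s = H (\<tau> (Suc i)) s - H (\<tau> i) s" for i s
      define \<psi> where "\<psi> s = (\<Sum>i<k. \<phi> (\<tau> i) * J i s)" for s
      have J_ind: "J i s = indicator {\<tau> i<..\<tau> (Suc i)} s" for i s
        using h by (auto simp: J_def H_def \<tau>_Suc)
      have Jnn: "0 \<le> J i s" for i s by (simp add: J_ind)
      have bJ: "bounded (range (\<lambda>x. J i (u x)))" for i and u :: "'b \<Rightarrow> real"
        unfolding J_ind by (auto simp: bounded_range_real indicator_def intro!: exI[of _ 1])
      have b\<psi>: "bounded (range (\<lambda>x. \<psi> (u x)))" for u :: "'b \<Rightarrow> real"
        unfolding \<psi>_def by (intro bounded_range_sum bounded_range_scale bJ)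
      have approx: "\<bar>\<phi> s - \<psi> s\<bar> \<le> \<epsilon>" if s: "\<tau> 0 < s" "s \<le> \<tau> k" for s
      proof -
        have "(\<Sum>i<k. J i s) = H (\<tau> k) s - H (\<tau> 0) s"
          unfolding J_def by (rule sum_lessThan_telescope)
        then have one: "(\<Sum>i<k. J i s) = 1" using s by (simp add: H_def)
        have "\<phi> s - \<psi> s = \<phi> s * (\<Sum>i<k. J i s) - \<psi> s" by (simp add: one)
        also have "\<dots> = (\<Sum>i<k. (\<phi> s - \<phi> (\<tau> i)) * J i s)"
          by (simp add: \<psi>_def sum_distrib_left sum_subtractf algebra_simps)
        also have "\<bar>\<dots>\<bar> \<le> (\<Sum>i<k. \<epsilon> * J i s)"
        proof (rule order.trans[OF sum_abs sum_mono])
          fix i assume "i \<in> {..<k}"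
          then have i: "i < k" by simp
          show "\<bar>(\<phi> s - \<phi> (\<tau> i)) * J i s\<bar> \<le> \<epsilon> * J i s"
          proof (cases "\<tau> i < s \<and> s \<le> \<tau> (Suc i)")
            case True
            have "dist (\<phi> s) (\<phi> (\<tau> i)) < \<epsilon>"
              using True i \<tau>_bounds[of i] \<tau>_bounds[of "Suc i"] h
              by (intro \<delta>(2)) (auto simp: dist_real_def \<tau>_Suc)
            then show ?thesis by (simp add: J_ind dist_real_def abs_mult mult_right_mono)
          qed (simp add: J_ind)
        qed
        also have "\<dots> = \<epsilon>" by (simp add: sum_distrib_left[symmetric] one)
        finally show ?thesis .
      qed
      have \<Lambda>J: "\<Lambda> (\<lambda>x. J i (e x)) = F (\<tau> (Suc i)) - F (\<tau> i)" for i
        unfolding J_def F_def by (intro diff bH)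
      have \<nu>J: "(\<integral>s. J i s \<partial>\<nu>) = F (\<tau> (Suc i)) - F (\<tau> i)" if "i < k" for i
      proof -
        have "(\<integral>s. J i s \<partial>\<nu>) = measure \<nu> {\<tau> i<..\<tau> (Suc i)}"
          unfolding J_ind using \<nu> by simp
        also have "\<dots> = G (\<tau> (Suc i)) - G (\<tau> i)"
          unfolding \<nu>_def using h by (intro measure_interval_measure_Ioc) (auto simp: G_mono G_cont \<tau>_Suc)
        also have "\<dots> = F (\<tau> (Suc i)) - F (\<tau> i)"
          using a(3)[of i] a(3)[of "Suc i"] that GF by (simp add: \<tau>_def)
        finally show ?thesis .
      qed
      have Ji: "integrable \<nu> (J i)" for i
        unfolding J_ind using \<nu> by (simp add: \<nu>.emeasure_finite less_top[symmetric])
      have "\<Lambda> (\<lambda>x. \<psi> (e x)) = (\<Sum>i<k. \<Lambda> (\<lambda>x. \<phi> (\<tau> i) * J i (e x)))"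
        unfolding \<psi>_def by (intro sum bounded_range_scale bJ)
      also have "\<dots> = (\<Sum>i<k. \<phi> (\<tau> i) * (F (\<tau> (Suc i)) - F (\<tau> i)))"
        by (simp add: scale[OF bJ] \<Lambda>J)
      also have "\<dots> = (\<integral>s. \<psi> s \<partial>\<nu>)"
        unfolding \<psi>_def using Ji \<nu>J by (simp add: Bochner_Integration.integral_sum)
      finally have eq: "\<Lambda> (\<lambda>x. \<psi> (e x)) = (\<integral>s. \<psi> s \<partial>\<nu>)" .
      have \<psi>i: "integrable \<nu> \<psi>" unfolding \<psi>_def using Ji by auto
      \<comment> \<open>The outer nodes lie on either side of [0, 1], so the cells carry the full
        mass and \<open>approx\<close> applies almost everywhere.\<close>
      have "measure \<nu> {\<tau> 0<..\<tau> k} = G (\<tau> k) - G (\<tau> 0)"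
        unfolding \<nu>_def using \<tau>0 \<tau>k by (intro measure_interval_measure_Ioc) (auto simp: G_mono G_cont)
      then have "measure \<nu> {\<tau> 0<..\<tau> k} = measure \<nu> (space \<nu>)"
        using \<tau>0 \<tau>k by (simp add: G_low G_high \<nu>(2) total)
      then have AE: "AE s in \<nu>. \<tau> 0 < s \<and> s \<le> \<tau> k"
        using \<nu>.finite_measure_compl[of "{\<tau> 0<..\<tau> k}"] \<nu>
        by (intro AE_I[of _ _ "space \<nu> - {\<tau> 0<..\<tau> k}"]) (auto simp: \<nu>.emeasure_eq_measure)
      have "\<bar>(\<integral>s. \<phi> s \<partial>\<nu>) - (\<integral>s. \<psi> s \<partial>\<nu>)\<bar> = \<bar>\<integral>s. \<phi> s - \<psi> s \<partial>\<nu>\<bar>"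
        using \<phi>i \<psi>i by simp
      also have "\<dots> \<le> (\<integral>s. \<bar>\<phi> s - \<psi> s\<bar> \<partial>\<nu>)" by (rule integral_abs_bound)
      also have "\<dots> \<le> (\<integral>s. \<epsilon> \<partial>\<nu>)"
        using AE approx \<phi>i \<psi>i by (intro integral_mono_AE) auto
      also have "\<dots> = \<epsilon> * M" using total \<nu>(2) by simp
      finally have 1: "\<bar>(\<integral>s. \<phi> s \<partial>\<nu>) - (\<integral>s. \<psi> s \<partial>\<nu>)\<bar> \<le> \<epsilon> * M" .
      have "\<bar>\<Lambda> (\<lambda>x. \<phi> (e x)) - \<Lambda> (\<lambda>x. \<psi> (e x))\<bar> \<le> \<epsilon> * M"
        unfolding M_def using e \<tau>0 \<tau>k
        by (intro abs_diff_le b\<phi> b\<psi> approx) (smt (verit))+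
      then show ?thesis using 1 eq by linarith
    qed
    have "\<bar>(\<integral>t. \<phi> t \<partial>\<nu>) - \<Lambda> (\<lambda>x. \<phi> (e x))\<bar> \<le> 0 + \<epsilon>" if "0 < \<epsilon>" for \<epsilon>
    proof -
      \<comment> \<open>The errors from the integral and from \<Lambda> add up to
        \<open>2 * M\<close> times the tolerance; \<open>M + 1\<close> guards against
        \<open>M = 0\<close>.\<close>
      define \<epsilon>' where "\<epsilon>' = \<epsilon> / (2 * (M + 1))"
      have "0 < \<epsilon>'" "\<epsilon>' * (2 * (M + 1)) = \<epsilon>" using M that by (simp_all add: \<epsilon>'_def)
      then show ?thesis using close[of \<epsilon>'] by (simp add: algebra_simps)
    qed
    then show "(\<integral>t. \<phi> t \<partial>\<nu>) = \<Lambda> (\<lambda>x. \<phi> (e x))"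
      using field_le_epsilon[of "\<bar>(\<integral>t. \<phi> t \<partial>\<nu>) - \<Lambda> (\<lambda>x. \<phi> (e x))\<bar>" 0] by simp
  qed (use \<nu> fin in auto)
qed

end

section \<open>Coding points of a compact set by real numbers\<close>

lemma ternary_digits_agree:
  fixes x y :: "nat \<Rightarrow> bool"
  defines "e \<equiv> \<lambda>x. suminf (\<lambda>k. of_bool (x k) * (1/3 :: real) ^ Suc k)"
  assumes close: "\<bar>e x - e y\<bar> < (1/3) ^ Suc K / 2" and "k \<le> K"
  shows "x k = y k"
proof (rule ccontr)
  assume "x k \<noteq> y k"
  \<comment> \<open>The first differing digit changes the value by \<open>(1/3) ^ Suc m\<close>,
    while all later digits together change it by at most half of that. In base 2 with digits 0 and 1
    the later digits could cancel the change.\<close>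
  define m where "m = (LEAST k. x k \<noteq> y k)"
  have m: "x m \<noteq> y m" "m \<le> K"
    using LeastI[of "\<lambda>k. x k \<noteq> y k", OF \<open>x k \<noteq> y k\<close>]
      Least_le[of "\<lambda>k. x k \<noteq> y k", OF \<open>x k \<noteq> y k\<close>] \<open>k \<le> K\<close> unfolding m_def by auto
  have before: "x j = y j" if "j < m" for j
    using not_less_Least[of j "\<lambda>k. x k \<noteq> y k"] that unfolding m_def by blast
  define c :: "nat \<Rightarrow> real" where "c j = (of_bool (x j) - of_bool (y j)) * (1/3) ^ Suc j" for j
  have geo: "summable (\<lambda>j. (1/3 :: real) ^ Suc (j + i))" for i
    using summable_mult[OF summable_geometric[of "1/3 :: real"], of "(1/3) ^ Suc i"]
    by (simp add: power_add mult_ac)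
  have sm: "summable (\<lambda>j. of_bool (z j) * (1/3 :: real) ^ Suc j)" for z :: "nat \<Rightarrow> bool"
    by (rule summable_comparison_test'[OF geo[of 0], of 0]) auto
  have c: "summable c" "e x - e y = suminf c"
    unfolding c_def e_def left_diff_distrib
    using sm by (auto intro!: summable_diff suminf_diff simp del: power_Suc)
  have "suminf c = suminf (\<lambda>j. c (j + Suc m)) + sum c {..<Suc m}"
    by (rule suminf_split_initial_segment[OF c(1)])
  also have "sum c {..<Suc m} = c m" using before by (simp add: c_def)
  finally have split: "e x - e y = suminf (\<lambda>j. c (j + Suc m)) + c m" using c(2) by simp
  have "\<bar>suminf (\<lambda>j. c (j + Suc m))\<bar> \<le> suminf (\<lambda>j. (1/3) ^ Suc (j + Suc m))"
    using geo[of "Suc m"] unfolding real_norm_def[symmetric]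
    by (intro norm_suminf_le) (auto simp: c_def abs_mult)
  also have "\<dots> = suminf (\<lambda>j. (1/3) ^ Suc (Suc m) * (1/3) ^ j)"
    by (intro suminf_cong) (simp add: power_add)
  also have "\<dots> = (1/3) ^ Suc (Suc m) * suminf (\<lambda>j. (1/3) ^ j)"
    by (rule suminf_mult) (simp add: summable_geometric)
  also have "\<dots> = (1/3) ^ Suc m / 2" by (simp add: suminf_geometric)
  finally have "\<bar>suminf (\<lambda>j. c (j + Suc m))\<bar> \<le> (1/3) ^ Suc m / 2" .
  moreover have "\<bar>c m\<bar> = (1/3) ^ Suc m" using m(1) by (auto simp: c_def)
  ultimately have "(1/3) ^ Suc m / 2 \<le> \<bar>e x - e y\<bar>" unfolding split by linarith
  moreover have "(1/3 :: real) ^ Suc K \<le> (1/3) ^ Suc m"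
    using m(2) by (intro power_decreasing) auto
  ultimately show False using close by (simp del: power_Suc)
qed

text \<open>
  The code of a point is the ternary number whose digits record membership in the members of a
  countable basis. By compactness finitely many digits determine the point up to a given error, so
  decoding is uniformly continuous on the set of codes.
\<close>

lemma compact_set_decoding:
  fixes S :: "'b::euclidean_space set"
  assumes "compact S"
  obtains e :: "'b \<Rightarrow> real" and D :: "real \<Rightarrow> 'b" where
    "continuous_on UNIV D" "\<And>x. x \<in> S \<Longrightarrow> D (e x) = x" "\<And>x. 0 \<le> e x" "\<And>x. e x \<le> 1"
proof -
  obtain \<B> :: "'b set set" where \<B>: "countable \<B>" "topological_basis \<B>"
    using ex_countable_basis by blast
  define B where "B = from_nat_into \<B>"
  define e :: "'b \<Rightarrow> real" where "e x = suminf (\<lambda>k. of_bool (x \<in> B k) * (1/3) ^ Suc k)" for x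
  have \<B>_ne: "\<B> \<noteq> {}" using topological_basis_open[OF \<B>(2)] \<B>(2)
    by (metis UNIV_I empty_iff open_UNIV topological_basisE)
  have geo: "(\<lambda>k. (1/3 :: real) ^ Suc k) sums (1/2)"
    using sums_mult[OF geometric_sums[of "1/3 :: real"], of "1/3"] by simp
  have sm: "summable (\<lambda>k. of_bool (x \<in> B k) * (1/3 :: real) ^ Suc k)" for x
    by (rule summable_comparison_test'[OF sums_summable[OF geo], of 0]) auto
  have e0: "0 \<le> e x" for x unfolding e_def by (intro suminf_nonneg sm) auto
  have e1: "e x \<le> 1" for x
  proof -
    have "e x \<le> suminf (\<lambda>k. (1/3) ^ Suc k)"
      unfolding e_def by (intro suminf_le sm sums_summable[OF geo]) auto
    then show ?thesis using sums_unique[OF geo] by simp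
  qed
  have uc: "\<exists>\<delta>>0. \<forall>x\<in>S. \<forall>y\<in>S. \<bar>e x - e y\<bar> < \<delta> \<longrightarrow> dist x y < \<epsilon>" if \<epsilon>: "0 < \<epsilon>" for \<epsilon>
  proof -
    have "\<exists>k. x \<in> B k \<and> B k \<subseteq> ball x (\<epsilon>/2)" if "x \<in> S" for x
    proof -
      obtain U where "U \<in> \<B>" "x \<in> U" "U \<subseteq> ball x (\<epsilon>/2)"
        using topological_basisE[OF \<B>(2), of "ball x (\<epsilon>/2)" x] \<epsilon> by auto
      moreover obtain k where "B k = U"
        using from_nat_into_surj[OF \<B>(1) \<open>U \<in> \<B>\<close>] unfolding B_def by blast
      ultimately show ?thesis by blast
    qed
    then have "\<forall>x\<in>S. \<exists>k. x \<in> B k \<and> B k \<subseteq> ball x (\<epsilon>/2)" by blast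
    from bchoice[OF this] obtain n where n: "\<forall>x\<in>S. x \<in> B (n x) \<and> B (n x) \<subseteq> ball x (\<epsilon>/2)" ..
    have "open (B (n x))" for x
      unfolding B_def by (rule topological_basis_open[OF \<B>(2) from_nat_into[OF \<B>_ne]])
    moreover have "S \<subseteq> (\<Union>x\<in>S. B (n x))" using n by blast
    ultimately obtain S' where S': "S' \<subseteq> S" "finite S'" "S \<subseteq> (\<Union>x\<in>S'. B (n x))"
      using compactE_image[OF assms, of S "\<lambda>x. B (n x)"] by blast
    \<comment> \<open>The digits up to \<open>K\<close> include those of all members of the finite
      subcover; the inserted 0 covers an empty subcover.\<close>
    define K where "K = Max (insert 0 (n ` S'))"
    have K: "n z \<le> K" if "z \<in> S'" for z using S'(2) that by (simp add: K_def)
    show ?thesis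
    proof (intro exI[of _ "(1/3) ^ Suc K / 2"] conjI ballI impI)
      fix x y assume xy: "x \<in> S" "y \<in> S" and close: "\<bar>e x - e y\<bar> < (1/3) ^ Suc K / 2"
      obtain z where z: "z \<in> S'" "x \<in> B (n z)" using S'(3) xy(1) by blast
      then have "y \<in> B (n z)"
        using ternary_digits_agree[of "\<lambda>k. x \<in> B k" "\<lambda>k. y \<in> B k" K "n z"] close K[OF z(1)]
        unfolding e_def by simp
      moreover have "B (n z) \<subseteq> ball z (\<epsilon>/2)" using n z(1) S'(1) by blast
      ultimately have "x \<in> ball z (\<epsilon>/2)" "y \<in> ball z (\<epsilon>/2)" using z(2) by blast+
      then show "dist x y < \<epsilon>" using dist_triangle_half_r[of z x \<epsilon> y] by simp
    qed simp
  qed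
  have inj: "inj_on e S"
  proof (rule inj_onI)
    fix x y assume "x \<in> S" "y \<in> S" "e x = e y"
    then have "dist x y < \<epsilon>" if "0 < \<epsilon>" for \<epsilon> using uc[OF that] by auto
    then show "x = y" by (metis dist_nz less_irrefl)
  qed
  have "uniformly_continuous_on (e ` S) (inv_into S e)"
    unfolding uniformly_continuous_on_def dist_real_def
    using uc by (fastforce simp: inv_into_f_f[OF inj] abs_minus_commute)
  \<comment> \<open>The codes need not form a closed set. Uniform continuity carries the decoding to
    their closure, and Tietze's theorem from there to the whole line.\<close>
  then obtain g where g: "uniformly_continuous_on (closure (e ` S)) g"
    "\<And>t. t \<in> e ` S \<Longrightarrow> inv_into S e t = g t"
    using uniformly_continuous_on_extension_on_closure by metis
  then obtain D where D: "continuous_on UNIV D" "\<And>t. t \<in> closure (e ` S) \<Longrightarrow> D t = g t"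
    using Tietze_unbounded[of "closure (e ` S)" g UNIV] uniformly_continuous_imp_continuous
    by (metis closed_closedin closed_closure subtopology_UNIV)
  have "D (e x) = x" if "x \<in> S" for x
    using D(2)[of "e x"] g(2)[of "e x"] inv_into_f_f[OF inj that] that closure_subset[of "e ` S"] by auto
  then show thesis using that D(1) e0 e1 by blast
qed

section \<open>From compact sets to Euclidean space\<close>

context positive_functional
begin

text \<open>Only decoding has to be continuous: then \<open>g\<close> composed with \<open>D\<close>
  is a continuous test function on the line, and evaluating it at the code \<open>e (u x)\<close>
  returns \<open>g (u x)\<close>.\<close>

lemma representation_compact:
  fixes u :: "'a \<Rightarrow> 'b::euclidean_space"
  assumes "compact S" and u: "\<And>x. u x \<in> S"
  obtains \<nu> :: "'b measure" where "sets \<nu> = sets borel" "finite_measure \<nu>"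
    "\<And>g. continuous_on UNIV g \<Longrightarrow> bounded (range g) \<Longrightarrow> (\<integral>z. g z \<partial>\<nu>) = \<Lambda> (\<lambda>x. g (u x))"
proof -
  obtain e and D :: "real \<Rightarrow> 'b" where D: "continuous_on UNIV D" "\<And>x. x \<in> S \<Longrightarrow> D (e x) = x"
    and e: "\<And>x. 0 \<le> e x" "\<And>x. e x \<le> 1"
    using compact_set_decoding[OF \<open>compact S\<close>] by metis
  obtain \<rho> :: "real measure" where \<rho>: "sets \<rho> = sets borel" "finite_measure \<rho>"
    "\<And>\<phi>. continuous_on UNIV \<phi> \<Longrightarrow> bounded (range \<phi>) \<Longrightarrow> (\<integral>t. \<phi> t \<partial>\<rho>) = \<Lambda> (\<lambda>x. \<phi> (e (u x)))"
    using representation_real[of "\<lambda>x. e (u x)"] e by metis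
  have Dm: "D \<in> measurable \<rho> borel"
    using borel_measurable_continuous_onI[OF D(1)] by (simp add: measurable_cong_sets[OF \<rho>(1) HOL.refl])
  show thesis
  proof (rule that[of "distr \<rho> borel D"])
    show "finite_measure (distr \<rho> borel D)" by (rule finite_measure.finite_measure_distr[OF \<rho>(2) Dm])
    fix g :: "'b \<Rightarrow> real" assume g: "continuous_on UNIV g" "bounded (range g)"
    have "(\<integral>z. g z \<partial>distr \<rho> borel D) = (\<integral>t. g (D t) \<partial>\<rho>)"
      using borel_measurable_continuous_onI[OF g(1)] by (intro integral_distr Dm) auto
    also have "\<dots> = \<Lambda> (\<lambda>x. g (D (e (u x))))"
      using g by (intro \<rho>(3) continuous_on_compose2[OF g(1) D(1)] bounded_subset[OF g(2)]) auto
    finally show "(\<integral>z. g z \<partial>distr \<rho> borel D) = \<Lambda> (\<lambda>x. g (u x))" using D(2) u by simp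
  qed simp
qed

end

lemma bounded_range_bounded_support:
  fixes f :: "'b::euclidean_space \<Rightarrow> real"
  assumes "continuous_on UNIV f" "\<And>x. R < norm x \<Longrightarrow> f x = 0"
  shows "bounded (range f)"
proof -
  have "bounded (f ` cball 0 R)"
    by (intro compact_imp_bounded compact_continuous_image continuous_on_subset[OF assms(1)]) auto
  then obtain B where B: "\<forall>x\<in>cball 0 R. \<bar>f x\<bar> \<le> B" unfolding bounded_iff by auto
  have "\<bar>f x\<bar> \<le> \<bar>B\<bar>" for x using B assms(2)[of x] by (cases "norm x \<le> R") force+
  then show ?thesis unfolding bounded_range_real by blast
qed

text \<open>
  The space is compactified by the radial homeomorphism \<open>x \<mapsto> x / (1 + |x|)\<close> onto the open unit ball;
  the mass on the unit sphere is discarded.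
\<close>

lemma positive_functional_representation:
  fixes \<Lambda> :: "('b::euclidean_space \<Rightarrow> real) \<Rightarrow> real"
  assumes "positive_functional \<Lambda>"
  obtains \<mu> :: "'b measure" where "sets \<mu> = sets borel" "finite_measure \<mu>"
    "\<And>f R. continuous_on UNIV f \<Longrightarrow> (\<And>x. R < norm x \<Longrightarrow> f x = 0) \<Longrightarrow> (\<integral>x. f x \<partial>\<mu>) = \<Lambda> f"
proof -
  interpret positive_functional \<Lambda> by (rule assms)
  define s :: "'b \<Rightarrow> 'b" where "s x = x /\<^sub>R (1 + norm x)" for x
  define T :: "'b \<Rightarrow> 'b" where "T z = z /\<^sub>R (1 - norm z)" for z
  have pos: "0 < 1 + norm x" for x :: 'b by (simp add: add_pos_nonneg)
  have norm_s: "norm (s x) = norm x / (1 + norm x)" for x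
    using pos[of x] by (simp add: s_def divide_inverse_commute)
  have "norm (s x) \<le> 1" for x
    using pos[of x] by (simp add: norm_s pos_divide_le_eq)
  then obtain \<nu> :: "'b measure" where \<nu>: "sets \<nu> = sets borel" "finite_measure \<nu>"
    "\<And>g. continuous_on UNIV g \<Longrightarrow> bounded (range g) \<Longrightarrow> (\<integral>z. g z \<partial>\<nu>) = \<Lambda> (\<lambda>x. g (s x))"
    using representation_compact[of "cball 0 1" s] by (metis compact_cball mem_cball_0)
  define \<nu>' where "\<nu>' = restrict_space \<nu> (ball 0 1)"
  have sp: "space \<nu> = UNIV" using sets_eq_imp_space_eq[OF \<nu>(1)] by simp
  have fin: "finite_measure \<nu>'"
    unfolding \<nu>'_def using \<nu>(1) by (intro finite_measure_restrict_space \<nu>(2)) (simp add: sp)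
  have "continuous_on (ball 0 1) T"
    unfolding T_def by (intro continuous_intros) auto
  then have "T \<in> measurable (restrict_space borel (ball 0 1)) borel"
    by (rule borel_measurable_continuous_on_restrict)
  then have Tm: "T \<in> measurable \<nu>' borel"
    by (simp add: \<nu>'_def measurable_cong_sets[OF sets_restrict_space_cong[OF \<nu>(1)] HOL.refl])
  show thesis
  proof (rule that[of "distr \<nu>' borel T"])
    show "finite_measure (distr \<nu>' borel T)" by (rule finite_measure.finite_measure_distr[OF fin Tm])
    fix f :: "'b \<Rightarrow> real" and R
    assume f: "continuous_on UNIV f" and supp: "\<And>x. R < norm x \<Longrightarrow> f x = 0"
    \<comment> \<open>If \<open>1 - norm z < c\<close>, dividing \<open>z\<close> by any positive
      \<open>t \<le> c\<close> gives a norm above \<open>(1 - c) / c = \<bar>R\<bar> + 1\<close>,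
      where \<open>f\<close> vanishes. Keeping the denominator at least \<open>c\<close> thus makes
      \<open>g\<close> continuous across the sphere without changing \<open>f (T z)\<close> inside
      it.\<close>
    define c where "c = 1 / (\<bar>R\<bar> + 2)"
    define g where "g z = f (z /\<^sub>R max (1 - norm z) c)" for z
    have c: "0 < c" "c < 1" by (simp_all add: c_def)
    have far: "f (z /\<^sub>R t) = 0" if "1 - norm z < c" "0 < t" "t \<le> c" for z :: 'b and t
    proof (rule supp)
      have "\<bar>R\<bar> + 1 = (1 - c) / c" by (simp add: c_def field_simps)
      also have "\<dots> < norm z / c" using that c by (intro divide_strict_right_mono) auto
      also have "\<dots> \<le> norm z / t" using that by (intro divide_left_mono) auto
      finally show "R < norm (z /\<^sub>R t)" using that by (simp add: divide_inverse mult.commute)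
    qed
    have gs: "g (s x) = f x" for x
    proof (cases "c \<le> 1 - norm (s x)")
      case True
      have p: "1 + norm x \<noteq> 0" using pos[of x] by simp
      have "1 - norm (s x) = inverse (1 + norm x)" using p by (simp add: norm_s field_simps)
      then show ?thesis using True p by (simp add: g_def max_def s_def)
    next
      case False
      note p = pos[of x]
      have *: "1 - norm (s x) = inverse (1 + norm x)" using p by (simp add: norm_s field_simps)
      have "f (s x /\<^sub>R (1 - norm (s x))) = 0" using False p by (intro far) (auto simp: *)
      moreover have "g (s x) = 0" using False c far[of "s x" c] by (simp add: g_def max_def)
      moreover have "s x /\<^sub>R (1 - norm (s x)) = x" unfolding * using p by (simp add: s_def)
      ultimately show ?thesis by simp
    qed
    \<comment> \<open>\<open>g\<close> vanishes on and beyond the unit sphere, so no integral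
      changes when the mass there is dropped.\<close>
    have gT: "indicator (ball 0 1) z * f (T z) = g z" for z
    proof (cases "1 - norm z < c")
      case True
      then show ?thesis
        using far[of z "1 - norm z"] far[of z c] c
        by (auto simp: g_def T_def max_def indicator_def)
    next
      case False
      then have "norm z < 1" using c by simp
      then show ?thesis using False by (simp add: g_def T_def max_def)
    qed
    have "continuous_on UNIV (\<lambda>z :: 'b. z /\<^sub>R max (1 - norm z) c)"
      using c by (intro continuous_intros) (simp add: max_def)
    then have gc: "continuous_on UNIV g"
      unfolding g_def by (rule continuous_on_compose2[OF f]) simp
    have gb: "bounded (range g)"
      by (rule bounded_subset[OF bounded_range_bounded_support[OF f supp]]) (auto simp: g_def)
    have fm: "f \<in> borel_measurable borel" using f by (rule borel_measurable_continuous_onI)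
    have "(\<integral>x. f x \<partial>distr \<nu>' borel T) = (\<integral>z. f (T z) \<partial>\<nu>')" by (rule integral_distr[OF Tm fm])
    also have "\<dots> = (\<integral>z. indicator (ball 0 1) z *\<^sub>R f (T z) \<partial>\<nu>)"
      unfolding \<nu>'_def by (subst integral_restrict_space) (simp_all add: \<nu>(1) sp)
    also have "\<dots> = \<Lambda> f" using \<nu>(3)[OF gc gb] by (simp add: gT gs)
    finally show "(\<integral>x. f x \<partial>distr \<nu>' borel T) = \<Lambda> f" .
  qed simp
qed

section \<open>Adapted spaces\<close>

definition cutoff :: "nat \<Rightarrow> 'b::real_normed_vector \<Rightarrow> real" where
  "cutoff R x = max 0 (min 1 (real R + 1 - norm x))"

lemma cutoff_bounds: "0 \<le> cutoff R x" "cutoff R x \<le> 1"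
  by (simp_all add: cutoff_def)

lemma cutoff_eq_1: "norm x \<le> real R \<Longrightarrow> cutoff R x = 1"
  and cutoff_eq_0: "real R + 1 < norm x \<Longrightarrow> cutoff R x = 0"
  by (simp_all add: cutoff_def)

lemma cutoff_mono: "R \<le> R' \<Longrightarrow> cutoff R x \<le> cutoff R' x"
  by (simp add: cutoff_def)

lemma continuous_on_cutoff: "continuous_on A (cutoff R)"
  unfolding cutoff_def by (intro continuous_intros)

lemma eventually_cutoff: "eventually (\<lambda>R. cutoff R x = 1) sequentially"
proof -
  obtain n where "norm x \<le> real n" using real_arch_simple by blast
  then show ?thesis
    by (intro eventually_sequentiallyI[of n] cutoff_eq_1) (simp add: order.trans)
qed

text \<open>Trades the truncation error for a growth factor divided by the radius; the growth factor
  is what the domination hypothesis absorbs.\<close>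

lemma one_minus_cutoff: "1 - cutoff R x \<le> (1 + norm x) / (real R + 1)"
proof (cases "norm x \<le> real R")
  case True
  then show ?thesis by (simp add: cutoff_eq_1)
next
  case False
  then have "1 \<le> (1 + norm x) / (real R + 1)" by (simp add: field_simps)
  then show ?thesis using cutoff_bounds(1)[of R x] by linarith
qed

text \<open>\<open>P\<close> consists of abstract vectors with an evaluation, so polynomials need
  not be identified with functions. By \<open>pos\<close>, \<open>L\<close> is monotone with respect
  to values on \<open>K\<close>, and the infimum of \<open>L\<close> over majorants is a finite
  sublinear functional because constants lie in \<open>P\<close>.\<close>

theorem positive_extension_representation:
  fixes K :: "'b::euclidean_space set" and P :: "'v::real_vector set"
    and ev :: "'v \<Rightarrow> 'b \<Rightarrow> real" and L :: "'v \<Rightarrow> real"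
  assumes K: "closed K" and P: "subspace P" and L: "linear L" and ev: "\<And>a. linear (\<lambda>p. ev p a)"
    and cont: "\<And>p. p \<in> P \<Longrightarrow> continuous_on UNIV (ev p)"
    and one: "e1 \<in> P" "\<And>a. ev e1 a = 1"
    and pos: "\<And>p. p \<in> P \<Longrightarrow> (\<And>a. a \<in> K \<Longrightarrow> 0 \<le> ev p a) \<Longrightarrow> 0 \<le> L p"
    and dom: "\<And>p. p \<in> P \<Longrightarrow> \<exists>v\<in>P. \<forall>a\<in>K. (1 + norm a) * \<bar>ev p a\<bar> \<le> ev v a"
  obtains \<mu> where "sets \<mu> = sets (restrict_space borel K)"
    "\<And>p. p \<in> P \<Longrightarrow> integrable \<mu> (ev p)" "\<And>p. p \<in> P \<Longrightarrow> (\<integral>a. ev p a \<partial>\<mu>) = L p"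
proof -
  note P_add = subspace_add[OF P] and P_scale = subspace_scale[OF P] and P_0 = subspace_0[OF P]
  note L_add = linear_add[OF L] and L_scale = linear_scale[OF L] and L_0 = linear_0[OF L]
  have ev_add: "ev (p + r) a = ev p a + ev r a" for p r a using linear_add[OF ev] .
  have ev_scale: "ev (c *\<^sub>R p) a = c * ev p a" for p c a using linear_scale[OF ev] by simp
  have ev_0: "ev 0 a = 0" for a using linear_0[OF ev] .
  have L_mono: "L p \<le> L r" if "p \<in> P" "r \<in> P" "\<And>a. a \<in> K \<Longrightarrow> ev p a \<le> ev r a" for p r
  proof -
    have "0 \<le> L (r + (- 1) *\<^sub>R p)"
      using that by (intro pos P_add P_scale) (simp_all only: ev_add ev_scale, simp)
    then show ?thesis unfolding L_add L_scale by simp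
  qed
  define E where "E = {f :: 'b \<Rightarrow> real. bounded (range f)}"
  define U where "U f = {v \<in> P. \<forall>a\<in>K. f a \<le> ev v a}" for f
  define q where "q f = Inf (L ` U f)" for f
  interpret E: function_space E
  proof
    show "(\<lambda>_. 0) \<in> E" by (auto simp: E_def bounded_range_real)
  qed (auto simp: E_def bounded_range_add bounded_range_scale)
  have U_ne: "U f \<noteq> {}" if fE: "f \<in> E" for f
  proof -
    obtain B where "\<And>a. \<bar>f a\<bar> \<le> B" using fE unfolding E_def bounded_range_real mem_Collect_eq by blast
    then have "B *\<^sub>R e1 \<in> U f" using one P_scale by (auto simp: U_def ev_scale abs_le_iff)
    then show ?thesis by blast
  qed
  have q_le: "q f \<le> L v" if fE: "f \<in> E" and "v \<in> P" "\<And>a. a \<in> K \<Longrightarrow> f a \<le> ev v a" for f v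
    unfolding q_def
  proof (rule cInf_lower)
    show "L v \<in> L ` U f" using that by (auto simp: U_def)
    obtain B where B: "\<And>a. \<bar>f a\<bar> \<le> B" using fE unfolding E_def bounded_range_real mem_Collect_eq by blast
    show "bdd_below (L ` U f)"
    proof (rule bdd_belowI2)
      fix w assume w: "w \<in> U f"
      show "L ((- B) *\<^sub>R e1) \<le> L w"
      proof (rule L_mono)
        fix a assume "a \<in> K"
        then have "f a \<le> ev w a" using w by (simp add: U_def)
        then show "ev ((- B) *\<^sub>R e1) a \<le> ev w a" using B[of a] unfolding ev_scale one by simp
      qed (use w in \<open>auto simp: U_def intro: P_scale[OF one(1), of "- B", simplified]\<close>)
    qed
  qed
  have le_q: "c \<le> q f" if "f \<in> E" "\<And>v. v \<in> P \<Longrightarrow> (\<And>a. a \<in> K \<Longrightarrow> f a \<le> ev v a) \<Longrightarrow> c \<le> L v" for f c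
    unfolding q_def using U_ne[OF that(1)] that(2) by (intro cInf_greatest) (auto simp: U_def)
  have sub: "sublinear_on E q"
    unfolding sublinear_on_def
  proof (intro conjI ballI allI impI)
    fix f g assume E: "f \<in> E" "g \<in> E"
    have "q (\<lambda>x. f x + g x) - L w \<le> L v"
      if "v \<in> P" "\<And>a. a \<in> K \<Longrightarrow> f a \<le> ev v a" "w \<in> P" "\<And>a. a \<in> K \<Longrightarrow> g a \<le> ev w a" for v w
      using q_le[OF E.add_mem[OF E] P_add[OF that(1,3)]] that(2,4)
      by (simp add: L_add ev_add add_mono)
    then have "q (\<lambda>x. f x + g x) - L w \<le> q f"
      if "w \<in> P" "\<And>a. a \<in> K \<Longrightarrow> g a \<le> ev w a" for w
      using that by (intro le_q E) auto
    then have "q (\<lambda>x. f x + g x) - q f \<le> q g"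
      by (intro le_q E) (simp add: algebra_simps)
    then show "q (\<lambda>x. f x + g x) \<le> q f + q g" by simp
  next
    fix f and c :: real assume E: "f \<in> E" and c: "0 < c"
    have "inverse c * q (\<lambda>x. c * f x) \<le> L v" if "v \<in> P" "\<And>a. a \<in> K \<Longrightarrow> f a \<le> ev v a" for v
      using q_le[OF E.scale_mem[OF E] P_scale[OF that(1)], of c c] that(2) c
      by (simp add: L_scale ev_scale field_simps)
    then have "inverse c * q (\<lambda>x. c * f x) \<le> q f" by (rule le_q[OF E])
    then show "q (\<lambda>x. c * f x) \<le> c * q f" using c by (simp add: field_simps)
  qed
  obtain \<Lambda> where \<Lambda>_add: "\<And>f g. f \<in> E \<Longrightarrow> g \<in> E \<Longrightarrow> \<Lambda> (\<lambda>x. f x + g x) = \<Lambda> f + \<Lambda> g"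
    and \<Lambda>_scale: "\<And>f c. f \<in> E \<Longrightarrow> \<Lambda> (\<lambda>x. c * f x) = c * \<Lambda> f"
    and \<Lambda>_q: "\<And>f. f \<in> E \<Longrightarrow> \<Lambda> f \<le> q f"
    by (rule E.sublinear_dominates_linear[OF sub]) (rule that)
  have \<Lambda>_le: "\<Lambda> f \<le> L v" if "bounded (range f)" "v \<in> P" "\<And>a. a \<in> K \<Longrightarrow> f a \<le> ev v a" for f v
    using \<Lambda>_q[of f] q_le[of f v] that by (force simp: E_def)
  \<comment> \<open>The zero vector majorises \<open>- f\<close> on \<open>K\<close>. Values of
    \<open>f\<close> off \<open>K\<close> do not matter, which later forces the measure onto
    \<open>K\<close>.\<close>
  have \<Lambda>_nonneg: "0 \<le> \<Lambda> f" if "bounded (range f)" "\<And>a. a \<in> K \<Longrightarrow> 0 \<le> f a" for f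
    using \<Lambda>_le[OF bounded_range_scale[OF that(1), of "- 1"] P_0] that
      \<Lambda>_scale[of f "- 1"] by (simp add: ev_0 L_0 E_def)
  have "positive_functional \<Lambda>"
    by standard (use \<Lambda>_add \<Lambda>_scale \<Lambda>_nonneg in \<open>auto simp: E_def\<close>)
  then obtain \<mu> :: "'b measure" where \<mu>: "sets \<mu> = sets borel" "finite_measure \<mu>"
    and \<mu>_int: "\<And>f R. continuous_on UNIV f \<Longrightarrow> (\<And>x. R < norm x \<Longrightarrow> f x = 0) \<Longrightarrow> (\<integral>x. f x \<partial>\<mu>) = \<Lambda> f"
    using positive_functional_representation by metis
  have sp: "space \<mu> = UNIV" using sets_eq_imp_space_eq[OF \<mu>(1)] by simp
  have meas: "f \<in> borel_measurable \<mu>" if "continuous_on UNIV f" for f :: "'b \<Rightarrow> real"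
    using borel_measurable_continuous_onI[OF that] by (simp add: measurable_cong_sets[OF \<mu>(1) HOL.refl])
  have cut: "continuous_on UNIV (\<lambda>x. cutoff R x * f x)" "bounded (range (\<lambda>x. cutoff R x * f x))"
    "(\<integral>x. cutoff R x * f x \<partial>\<mu>) = \<Lambda> (\<lambda>x. cutoff R x * f x)"
    "integrable \<mu> (\<lambda>x. cutoff R x * f x)" if f: "continuous_on UNIV f" for R and f :: "'b \<Rightarrow> real"
  proof -
    show c: "continuous_on UNIV (\<lambda>x. cutoff R x * f x)"
      by (intro continuous_intros continuous_on_cutoff f)
    show b: "bounded (range (\<lambda>x. cutoff R x * f x))"
      by (rule bounded_range_bounded_support[OF c, of "real R + 1"]) (simp add: cutoff_eq_0)
    show "(\<integral>x. cutoff R x * f x \<partial>\<mu>) = \<Lambda> (\<lambda>x. cutoff R x * f x)"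
      by (rule \<mu>_int[OF c, of "real R + 1"]) (simp add: cutoff_eq_0)
    obtain B where "\<And>x. \<bar>cutoff R x * f x\<bar> \<le> B" using b unfolding bounded_range_real by blast
    then show "integrable \<mu> (\<lambda>x. cutoff R x * f x)"
      by (intro finite_measure.integrable_const_bound[OF \<mu>(2), of _ B] meas c) auto
  qed
  have main: "integrable \<mu> (ev p) \<and> (\<integral>a. ev p a \<partial>\<mu>) = L p" if p: "p \<in> P" for p
  proof -
    obtain v where v: "v \<in> P" "\<And>a. a \<in> K \<Longrightarrow> (1 + norm a) * \<bar>ev p a\<bar> \<le> ev v a"
      using dom[OF p] by blast
    note c = cont[OF p]
    then have c': "continuous_on UNIV (\<lambda>a. \<bar>ev p a\<bar>)" by (intro continuous_intros)
    have lim: "(\<lambda>R. cutoff R a * y) \<longlonglongrightarrow> y" for a :: 'b and y :: real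
      using eventually_mono[OF eventually_cutoff[of a]] by (intro tendsto_eventually) auto
    \<comment> \<open>Integrability comes from monotone convergence: these truncated integrals
      increase and stay below \<open>L v\<close>, since \<open>v\<close> majorises
      \<open>\<bar>ev p\<bar>\<close> on \<open>K\<close>.\<close>
    define J where "J R = (\<integral>a. cutoff R a * \<bar>ev p a\<bar> \<partial>\<mu>)" for R
    have "incseq J"
      unfolding J_def incseq_def
      by (intro allI impI integral_mono cut c' mult_right_mono cutoff_mono) auto
    moreover have "J R \<le> L v" for R
    proof -
      have "J R = \<Lambda> (\<lambda>a. cutoff R a * \<bar>ev p a\<bar>)" unfolding J_def by (rule cut(3)[OF c'])
      also have "\<dots> \<le> L v"
      proof (rule \<Lambda>_le[OF cut(2)[OF c'] v(1)])
        fix a assume "a \<in> K"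
        have "cutoff R a * \<bar>ev p a\<bar> \<le> (1 + norm a) * \<bar>ev p a\<bar>"
          using cutoff_bounds(2)[of R a] norm_ge_zero[of a] by (intro mult_right_mono) linarith+
        then show "cutoff R a * \<bar>ev p a\<bar> \<le> ev v a" using v(2)[OF \<open>a \<in> K\<close>] by simp
      qed
      finally show ?thesis .
    qed
    ultimately obtain l where l: "J \<longlonglongrightarrow> l"
      using incseq_convergent[of J "L v"] by blast
    have "integrable \<mu> (\<lambda>a. \<bar>ev p a\<bar>)"
    proof (rule integrable_monotone_convergence)
      show "AE a in \<mu>. mono (\<lambda>R. cutoff R a * \<bar>ev p a\<bar>)"
        by (auto simp: mono_def intro!: mult_right_mono cutoff_mono)
      show "AE a in \<mu>. (\<lambda>R. cutoff R a * \<bar>ev p a\<bar>) \<longlonglongrightarrow> \<bar>ev p a\<bar>" by (simp add: lim)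
      show "(\<lambda>R. \<integral>a. cutoff R a * \<bar>ev p a\<bar> \<partial>\<mu>) \<longlonglongrightarrow> l" using l by (simp add: J_def[abs_def])
      show "(\<lambda>a. \<bar>ev p a\<bar>) \<in> borel_measurable \<mu>" by (rule meas[OF c'])
    qed (rule cut(4)[OF c'])
    then have int: "integrable \<mu> (ev p)"
      using integrable_abs_iff[OF meas[OF c]] by simp
    have "(\<lambda>R. \<integral>a. cutoff R a * ev p a \<partial>\<mu>) \<longlonglongrightarrow> (\<integral>a. ev p a \<partial>\<mu>)"
    proof (rule integral_dominated_convergence[where w = "\<lambda>a. \<bar>ev p a\<bar>"])
      show "AE a in \<mu>. norm (cutoff R a * ev p a) \<le> \<bar>ev p a\<bar>" for R
        by (intro AE_I2) (simp add: abs_mult cutoff_bounds mult_left_le_one_le)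
    qed (use int lim meas c cut in auto)
    moreover have "(\<lambda>R. \<integral>a. cutoff R a * ev p a \<partial>\<mu>) \<longlonglongrightarrow> L p"
    proof (rule LIM_zero_cancel, rule Lim_null_comparison)
      show "(\<lambda>R. L v * (1 / (real R + 1))) \<longlonglongrightarrow> 0"
        using tendsto_mult_right_zero[OF LIMSEQ_inverse_real_of_nat, of "L v"]
        by (simp add: inverse_eq_divide add.commute)
      show "eventually (\<lambda>R. norm ((\<integral>a. cutoff R a * ev p a \<partial>\<mu>) - L p) \<le> L v * (1 / (real R + 1))) sequentially"
      proof (rule always_eventually, rule allI)
        fix R
        let ?r = "1 / (real R + 1)"
        have "\<bar>ev p a - cutoff R a * ev p a\<bar> \<le> ?r * ev v a" if "a \<in> K" for a
        proof -
          have "\<bar>ev p a - cutoff R a * ev p a\<bar> = \<bar>(1 - cutoff R a) * ev p a\<bar>"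
            by (simp add: algebra_simps)
          also have "\<dots> = (1 - cutoff R a) * \<bar>ev p a\<bar>"
            using cutoff_bounds(2)[of R a] by (simp add: abs_mult)
          also have "\<dots> \<le> (1 + norm a) / (real R + 1) * \<bar>ev p a\<bar>"
            by (intro mult_right_mono one_minus_cutoff) auto
          also have "\<dots> = ?r * ((1 + norm a) * \<bar>ev p a\<bar>)" by simp
          also have "\<dots> \<le> ?r * ev v a" by (intro mult_left_mono v(2) that) simp
          finally show ?thesis .
        qed
        \<comment> \<open>\<Lambda> is bounded only from above, by \<open>L\<close> of a majorant,
          so the truncated function and its negative both need one.\<close>
        then have near: "cutoff R a * ev p a \<le> ev p a + ?r * ev v a"
          "(- 1) * (cutoff R a * ev p a) \<le> (- 1) * ev p a + ?r * ev v a" if "a \<in> K" for a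
          using that by (force simp: abs_le_iff)+
        let ?f = "\<lambda>a. cutoff R a * ev p a"
        have "\<Lambda> ?f \<le> L (p + ?r *\<^sub>R v)"
          by (intro \<Lambda>_le cut(2) c P_add P_scale p v(1)) (simp only: ev_add ev_scale near)
        moreover have "\<Lambda> (\<lambda>a. (- 1) * ?f a) \<le> L ((- 1) *\<^sub>R p + ?r *\<^sub>R v)"
          by (intro \<Lambda>_le bounded_range_scale cut(2) c P_add P_scale p v(1)) (simp only: ev_add ev_scale near)
        moreover have "\<Lambda> (\<lambda>a. (- 1) * ?f a) = (- 1) * \<Lambda> ?f"
          using cut(2)[OF c] by (intro \<Lambda>_scale) (simp add: E_def)
        ultimately show "norm ((\<integral>a. ?f a \<partial>\<mu>) - L p) \<le> L v * ?r"
          unfolding cut(3)[OF c] L_add L_scale by (simp add: abs_le_iff)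
      qed
    qed
    ultimately show ?thesis using int LIMSEQ_unique by blast
  qed
  \<comment> \<open>\<open>infdist\<close> to the empty set is 0, so the empty \<open>K\<close>
    needs the value 1 to make \<open>h\<close> positive off \<open>K\<close>.\<close>
  define h :: "'b \<Rightarrow> real" where "h a = (if K = {} then 1 else infdist a K)" for a
  have hc: "continuous_on UNIV h"
    unfolding h_def by (cases "K = {}") (auto intro: continuous_on_infdist)
  have h: "0 \<le> h a" "a \<in> K \<Longrightarrow> h a = 0" "a \<notin> K \<Longrightarrow> 0 < h a" for a
    using in_closed_iff_infdist_zero[OF K, of a] infdist_nonneg[of a K]
    by (auto simp: h_def less_le)
  \<comment> \<open>The function vanishes on \<open>K\<close>, so \<Lambda> of it is at most 0;
    being nonnegative with this integral, it is 0 almost everywhere.\<close>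
  have "AE a in \<mu>. cutoff R a * h a = 0" for R
  proof -
    have "0 \<le> \<Lambda> (\<lambda>a. (- 1) * (cutoff R a * h a))"
      by (intro \<Lambda>_nonneg bounded_range_scale cut(2) hc) (simp add: h(2))
    then have "\<Lambda> (\<lambda>a. cutoff R a * h a) \<le> 0"
      using \<Lambda>_scale[of "\<lambda>a. cutoff R a * h a" "- 1"] cut(2)[OF hc, of R] by (simp add: E_def)
    moreover have nn: "0 \<le> cutoff R a * h a" for a
      by (intro mult_nonneg_nonneg cutoff_bounds(1) h(1))
    ultimately have "(\<integral>a. cutoff R a * h a \<partial>\<mu>) = 0"
      using Bochner_Integration.integral_nonneg[of \<mu> "\<lambda>a. cutoff R a * h a"] cut(3)[OF hc, of R] by simp
    then show ?thesis
      using integral_nonneg_eq_0_iff_AE[OF cut(4)[OF hc, of R]] nn by simp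
  qed
  then have "AE a in \<mu>. \<forall>R. cutoff R a * h a = 0" unfolding AE_all_countable ..
  then have AE_K: "AE a in \<mu>. a \<in> K"
  proof (rule AE_mp, intro AE_I2 impI)
    fix a assume a: "\<forall>R. cutoff R a * h a = 0"
    obtain R where "cutoff R a = 1"
      using eventually_happens'[OF sequentially_bot eventually_cutoff[of a]] by blast
    then have "h a = 0" using a[rule_format, of R] by simp
    then show "a \<in> K" using h(3)[of a] by auto
  qed
  have Ks: "K \<inter> space \<mu> \<in> sets \<mu>" using K \<mu>(1) sp by simp
  show thesis
  proof (rule that[of "restrict_space \<mu> K"])
    show "sets (restrict_space \<mu> K) = sets (restrict_space borel K)"
      by (rule sets_restrict_space_cong[OF \<mu>(1)])
    fix p assume p: "p \<in> P"
    have m: "ev p \<in> borel_measurable \<mu>" by (rule meas[OF cont[OF p]])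
    have AE: "AE a in \<mu>. indicator K a *\<^sub>R ev p a = ev p a" using AE_K by eventually_elim simp
    have m': "(\<lambda>a. indicator K a *\<^sub>R ev p a) \<in> borel_measurable \<mu>"
      using m Ks sp by (intro borel_measurable_scaleR borel_measurable_indicator) auto
    show "integrable (restrict_space \<mu> K) (ev p)"
      using main[OF p] integrable_cong_AE[OF m' m AE]
      by (simp add: integrable_restrict_space[OF Ks] set_integrable_def)
    show "(\<integral>a. ev p a \<partial>restrict_space \<mu> K) = L p"
      using main[OF p] integral_cong_AE[OF m' m AE]
      by (simp add: integral_restrict_space[OF Ks] set_lebesgue_integral_def)
  qed
qed

section \<open>Evaluations of polynomials\<close>

lemma bounded_linear_qRe: "bounded_linear qRe"
proof -
  have "qRe = (\<lambda>x. inner x 1)" by (simp add: fun_eq_iff inner_quat_def)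
  then show ?thesis using bounded_linear_inner_left[of "1 :: quat"] by metis
qed

lemma bounded_linear_qcnj: "bounded_linear qcnj"
  unfolding linear_conv_bounded_linear[symmetric]
  by (rule linearI) (simp_all add: quat_eq_iff)

lemma qRe_mult_commute: "qRe (x * y) = qRe (y * x)"
  by (simp add: algebra_simps)

lemma qcnj_fixed: "qcnj z = z \<Longrightarrow> z = of_real (qRe z)"
  by (simp add: quat_eq_iff)

lemma heval_scaleR: "heval a (r *\<^sub>R p) = r *\<^sub>R heval a p"
  by (simp add: scaleR_hfree_def scaleR_conv_of_real)

lemma heval_one: "heval a 1 = 1"
  using heval_simps(1)[of a 1] by simp

lemma heval_zero: "heval a 0 = 0"
  using heval_simps(1)[of a 0] by simp

lemma heval_sum: "heval a (sum f A) = (\<Sum>x\<in>A. heval a (f x))"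
  by (induction A rule: infinite_finite_induct) (simp_all add: heval_zero)

lemma heval_hstar: "heval a (hstar p) = qcnj (heval a p)"
proof transfer
  fix a :: "quat ^ 'a::finite" and t :: "'a hterm"
  show "term_eval (word_eval a) (term_star t) = qcnj (term_eval (word_eval a) t)"
    by (induction t) (simp_all add: word_eval_star)
qed

lemma hstar_scaleR: "hstar (r *\<^sub>R p) = r *\<^sub>R hstar p"
  by (simp add: scaleR_hfree_def hconst_central)

lemma hL_scaleR: "hL y (r *\<^sub>R p) = r * hL y p"
  unfolding scaleR_hfree_def by transfer (simp add: algebra_simps)

lemma continuous_on_word_eval: "continuous_on A (\<lambda>a. word_eval a w)"
proof transfer
  fix A :: "(quat ^ 'a::finite) set" and ls :: "'a letter list"
  have "continuous_on A (\<lambda>a. letter_eval a l)" for l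
    by (cases l) (auto intro!: continuous_intros bounded_linear.continuous_on[OF bounded_linear_qcnj])
  then show "continuous_on A (\<lambda>a. list_eval a ls)"
    unfolding list_eval_def by (induction ls) (auto intro!: continuous_intros)
qed

lemma continuous_on_heval: "continuous_on A (\<lambda>a. heval a p)"
proof transfer
  fix A :: "(quat ^ 'a::finite) set" and t :: "'a hterm"
  show "continuous_on A (\<lambda>a. term_eval (word_eval a) t)"
    by (induction t) (auto intro!: continuous_intros continuous_on_word_eval)
qed

definition weight :: "quat ^ 'n::finite \<Rightarrow> real" where
  "weight a = 1 + (\<Sum>i\<in>UNIV. (norm (a $ i))\<^sup>2)"

lemma weight_ge_1: "1 \<le> weight a"
  by (simp add: weight_def sum_nonneg)

lemma weight_power_mono: "m \<le> n \<Longrightarrow> weight a ^ m \<le> weight a ^ n"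
  by (rule power_increasing[OF _ weight_ge_1])

text \<open>The inequality \<open>2 t \<le> 1 + t^2\<close> replaces a norm by the weight, which is
  the value of a polynomial.\<close>

lemma norm_component_le_weight: "norm (a $ i) \<le> weight a"
proof -
  have "(norm (a $ i))\<^sup>2 \<le> (\<Sum>i\<in>UNIV. (norm (a $ i))\<^sup>2)"
    by (rule member_le_sum) auto
  moreover have "2 * norm (a $ i) \<le> 1 + (norm (a $ i))\<^sup>2"
    using sum_squares_bound[of 1 "norm (a $ i)"] by simp
  ultimately show ?thesis using norm_ge_zero[of "a $ i"] unfolding weight_def by linarith
qed

lemma norm_le_weight: "norm a \<le> weight a"
proof -
  have "(norm a)\<^sup>2 = (\<Sum>i\<in>UNIV. (norm (a $ i))\<^sup>2)"
    by (simp add: norm_vec_def L2_set_def sum_nonneg)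
  moreover have "2 * norm a \<le> 1 + (norm a)\<^sup>2"
    using sum_squares_bound[of 1 "norm a"] by simp
  ultimately show ?thesis using norm_ge_zero[of a] unfolding weight_def by linarith
qed

lemma word_eval_growth: "\<exists>m. \<forall>a. norm (word_eval a w) \<le> weight a ^ m"
proof transfer
  fix ls :: "'a letter list"
  have letter: "norm (letter_eval a l) \<le> weight a" for a :: "quat ^ 'a" and l
  proof (cases l)
    case (Qbar i)
    have "norm (qcnj (a $ i)) = norm (a $ i)" by (simp add: norm_quat_def inner_quat_def)
    then show ?thesis using Qbar norm_component_le_weight[of a i] by simp
  qed (simp add: norm_component_le_weight)
  have "norm (list_eval a ls) \<le> weight a ^ length ls" for a
  proof (induction ls)
    case (Cons l ls)
    have "norm (list_eval a (l # ls)) = norm (letter_eval a l) * norm (list_eval a ls)"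
      by (simp add: list_eval_def norm_mult)
    also have "\<dots> \<le> weight a * weight a ^ length ls"
      using Cons letter weight_ge_1[of a] by (intro mult_mono) auto
    finally show ?case by simp
  qed (simp add: list_eval_def)
  then show "\<exists>m. \<forall>a. norm (list_eval a ls) \<le> weight a ^ m" by blast
qed

lemma heval_growth: "\<exists>C m. 0 \<le> C \<and> (\<forall>a. norm (heval a p) \<le> C * weight a ^ m)"
proof transfer
  fix t :: "'a hterm"
  show "\<exists>C m. 0 \<le> C \<and> (\<forall>a. norm (term_eval (word_eval a) t) \<le> C * weight a ^ m)"
  proof (induction t)
    case (TConst h)
    show ?case by (intro exI[of _ "norm h"] exI[of _ 0]) simp
  next
    case (TWord w)
    obtain m where "\<forall>a. norm (word_eval a w) \<le> weight a ^ m" using word_eval_growth by blast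
    then show ?case by (intro exI[of _ 1] exI[of _ m]) simp
  next
    case (TAdd s t)
    then obtain C1 m1 C2 m2 where C: "0 \<le> C1" "0 \<le> C2"
      and 1: "\<And>a. norm (term_eval (word_eval a) s) \<le> C1 * weight a ^ m1"
      and 2: "\<And>a. norm (term_eval (word_eval a) t) \<le> C2 * weight a ^ m2" by metis
    have "norm (term_eval (word_eval a) (TAdd s t)) \<le> (C1 + C2) * weight a ^ (m1 + m2)" for a
    proof -
      have "norm (term_eval (word_eval a) (TAdd s t)) \<le> C1 * weight a ^ m1 + C2 * weight a ^ m2"
        using norm_triangle_mono[OF 1 2] by simp
      also have "\<dots> \<le> C1 * weight a ^ (m1 + m2) + C2 * weight a ^ (m1 + m2)"
        using C by (intro add_mono mult_left_mono weight_power_mono) auto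
      finally show ?thesis by (simp add: algebra_simps)
    qed
    then show ?case using C by (metis add_nonneg_nonneg)
  next
    case (TMul s t)
    then obtain C1 m1 C2 m2 where C: "0 \<le> C1" "0 \<le> C2"
      and 1: "\<And>a. norm (term_eval (word_eval a) s) \<le> C1 * weight a ^ m1"
      and 2: "\<And>a. norm (term_eval (word_eval a) t) \<le> C2 * weight a ^ m2" by metis
    have "norm (term_eval (word_eval a) (TMul s t)) \<le> (C1 * C2) * weight a ^ (m1 + m2)" for a
    proof -
      have "norm (term_eval (word_eval a) (TMul s t)) \<le> (C1 * weight a ^ m1) * (C2 * weight a ^ m2)"
        using 1 2 C weight_ge_1[of a] by (auto simp: norm_mult intro!: mult_mono)
      then show ?thesis by (simp add: power_add mult_ac)
    qed
    then show ?case using C by (metis mult_nonneg_nonneg)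
  qed
qed

section \<open>The space of symmetric polynomials\<close>

lemma poly_of_superset:
  assumes "finite A" "Poly_Mapping.keys c \<subseteq> A"
  shows "poly_of c = (\<Sum>(a, b)\<in>A. hword a * hconst (Poly_Mapping.lookup c (a, b)) * hword b)"
  unfolding poly_of_def using assms
  by (intro sum.mono_neutral_left) (auto simp: in_keys_iff)

lemma subspace_polyP: "subspace polyP"
proof (rule subspaceI)
  have "poly_of 0 = 0" by (simp add: poly_of_def)
  then show "0 \<in> polyP" unfolding polyP_def by (metis rangeI)
next
  fix p q :: "'n hfree" assume "p \<in> polyP" "q \<in> polyP"
  then obtain c d where pq: "p = poly_of c" "q = poly_of d" by (auto simp: polyP_def)
  let ?A = "Poly_Mapping.keys c \<union> Poly_Mapping.keys d"
  have fin: "finite ?A" by simp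
  have split: "hword a * hconst (h + k) * hword b =
      hword a * hconst h * hword b + hword a * hconst k * hword b" for a b :: "'n word" and h k
    by (simp add: hconst_add algebra_simps)
  have "poly_of (c + d) = p + q"
    unfolding pq using keys_add[of c d]
    by (simp add: poly_of_superset[OF fin] lookup_add split sum.distrib[symmetric] case_prod_unfold)
  then show "p + q \<in> polyP" unfolding polyP_def by (metis rangeI)
next
  fix r :: real and p :: "'n hfree" assume "p \<in> polyP"
  then obtain c where p: "p = poly_of c" by (auto simp: polyP_def)
  have pull: "hword a * hconst (of_real r * h) * hword b = r *\<^sub>R (hword a * hconst h * hword b)"
    for a b :: "'n word" and h
  proof -
    have "hconst (of_real r * h) = r *\<^sub>R (hconst h :: 'n hfree)"
      by (simp add: scaleR_hfree_def hconst_mult)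
    then show ?thesis by simp
  qed
  let ?d = "Poly_Mapping.map (\<lambda>h. of_real r * h) c"
  have "Poly_Mapping.keys ?d \<subseteq> Poly_Mapping.keys c"
    by (auto simp: in_keys_iff map.rep_eq)
  then have "poly_of ?d = (\<Sum>(a, b)\<in>Poly_Mapping.keys c.
      hword a * hconst (of_real r * Poly_Mapping.lookup c (a, b)) * hword b)"
    by (subst poly_of_superset[of "Poly_Mapping.keys c"])
      (auto simp: map.rep_eq when_def in_keys_iff intro!: sum.cong)
  also have "\<dots> = r *\<^sub>R p"
    unfolding p by (simp only: poly_of_def case_prod_unfold pull scaleR_sum_right)
  finally show "r *\<^sub>R p \<in> polyP" unfolding polyP_def by (metis rangeI)
qed

lemma monomial_in_polyP: "hword a * hconst h * hword b \<in> polyP"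
proof -
  have "poly_of (Poly_Mapping.single (a, b) h) = hword a * hconst h * hword b"
    by (subst poly_of_superset[of "{(a, b)}"]) (auto simp: lookup_single)
  then show ?thesis unfolding polyP_def by (metis rangeI)
qed

text \<open>A product of two polynomials separates their constants by a word and so leaves
  \<open>polyP\<close> in general. A word on the left is absorbed by the left factor of each
  monomial, which is enough for powers of \<open>hweight\<close>.\<close>

lemma hword_mult_polyP:
  assumes "p \<in> polyP"
  shows "hword u * p \<in> polyP"
proof -
  obtain c where "p = poly_of c" using assms by (auto simp: polyP_def)
  then have "hword u * p = (\<Sum>(a, b)\<in>Poly_Mapping.keys c.
      hword (u * a) * hconst (Poly_Mapping.lookup c (a, b)) * hword b)"
    by (simp add: poly_of_def sum_distrib_left case_prod_unfold mult.assoc hword_mult)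
  also have "\<dots> \<in> polyP"
    by (intro subspace_sum[OF subspace_polyP]) (auto simp: monomial_in_polyP)
  finally show ?thesis .
qed

lemma subspace_symP: "subspace symP"
  using subspace_polyP by (auto simp: symP_def subspace_def hstar_scaleR)

lift_definition sq_word :: "'n \<Rightarrow> 'n word" is "\<lambda>i. [Q i, Qbar i]" .

lemma word_star_sq_word [simp]: "word_star (sq_word i) = sq_word i"
  by transfer (simp add: list_star_def)

lemma word_eval_sq_word: "word_eval a (sq_word i) = of_real ((norm (a $ i))\<^sup>2)"
  by transfer (simp add: list_eval_def qcnj_mult_self)

definition hweight :: "'n::finite hfree" where
  "hweight = 1 + (\<Sum>i\<in>UNIV. hword (sq_word i))"

lemma heval_hweight_power: "heval a (hweight ^ m) = of_real (weight a ^ m)"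
proof -
  have "heval a hweight = of_real (weight a)"
    by (simp add: hweight_def weight_def heval_one heval_sum word_eval_sq_word)
  then show ?thesis by (induction m) (simp_all add: heval_one)
qed

lemma hweight_power_symP: "(hweight :: 'n::finite hfree) ^ m \<in> symP"
proof -
  have one: "(1 :: 'n hfree) \<in> polyP" using monomial_in_polyP[of 1 1 1] by simp
  have mult: "hweight * p \<in> polyP" if "p \<in> polyP" for p :: "'n hfree"
  proof -
    have "hweight * p = p + (\<Sum>i\<in>UNIV. hword (sq_word i) * p)"
      by (simp add: hweight_def algebra_simps sum_distrib_right)
    then show ?thesis
      using that by (auto intro!: subspace_add[OF subspace_polyP] subspace_sum[OF subspace_polyP] hword_mult_polyP)
  qed
  have "hstar (1 :: 'n hfree) = 1" using hstar_simps(1)[of 1] by simp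
  moreover from this have "hstar (hweight :: 'n hfree) = hweight"
    by (simp add: hweight_def hstar_sum)
  ultimately have "hstar (hweight ^ m :: 'n hfree) = hweight ^ m"
    by (induction m) (simp_all add: power_commutes)
  moreover have "(hweight :: 'n hfree) ^ m \<in> polyP" by (induction m) (auto simp: one mult)
  ultimately show ?thesis by (simp add: symP_def)
qed

lemma heval_symP: "p \<in> symP \<Longrightarrow> heval a p = of_real (qRe (heval a p))"
  using heval_hstar[of a p] by (intro qcnj_fixed) (simp add: symP_def)

text \<open>Polynomial growth supplies a bound \<open>C * weight a ^ m\<close>, and
  \<open>1 + norm a \<le> 2 * weight a\<close> costs one more power and a factor 2.\<close>

lemma symP_dominated:
  assumes "p \<in> symP"
  shows "\<exists>v\<in>symP. \<forall>a. (1 + norm a) * \<bar>qRe (heval a p)\<bar> \<le> qRe (heval a v)"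
proof -
  obtain C m where C: "0 \<le> C" "\<And>a. norm (heval a p) \<le> C * weight a ^ m"
    using heval_growth[of p] by blast
  have "(1 + norm a) * \<bar>qRe (heval a p)\<bar> \<le> qRe (heval a ((2 * C) *\<^sub>R hweight ^ Suc m))" for a
  proof -
    have "\<bar>qRe (heval a p)\<bar> = norm (heval a p)"
      by (subst (2) heval_symP[OF assms]) simp
    moreover have "(1 + norm a) * norm (heval a p) \<le> (2 * weight a) * (C * weight a ^ m)"
      using C norm_le_weight[of a] weight_ge_1[of a] by (intro mult_mono) auto
    ultimately show ?thesis
      by (simp only: heval_scaleR heval_hweight_power quat_scaleR_sel quat_of_real_sel)
        (simp add: mult_ac)
  qed
  then show ?thesis
    using subspace_scale[OF subspace_symP hweight_power_symP] by blast
qed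

section \<open>The two implications\<close>

lemma L_R_eq_hL:
  assumes "pseudo_moment y" "p \<in> polyP"
  shows "L_R y p = hL y p"
proof -
  obtain c where "p = poly_of c" using assms(2) by (auto simp: polyP_def)
  then show ?thesis
    by (simp only: L_R_poly_of[OF assms(1)])
      (simp only: poly_of_def hL_sum qRe_sum case_prod_unfold hL_monomial[OF assms(1)])
qed

text \<open>\<open>L_R y p\<close> is the integral of the real part of \<open>p\<close>. On a
  monomial the cyclic invariance of the real part moves the left word behind the right one,
  producing the moment \<open>y (b * a)\<close> of the definition.\<close>

lemma L_R_nonneg_if_representing:
  fixes K :: "(quat ^ 'n::finite) set"
  assumes y: "pseudo_moment y" and \<mu>: "representing_measure K y \<mu>" and p: "p \<in> nonneg_polys K"
  shows "0 \<le> L_R y p"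
proof -
  have sp: "space \<mu> = K"
    using \<mu> sets_eq_imp_space_eq[of \<mu> "restrict_space borel K"]
    by (simp add: representing_measure_def space_restrict_space)
  have int: "integrable \<mu> (\<lambda>a. word_eval a w)" and yw: "y w = (\<integral>a. word_eval a w \<partial>\<mu>)" for w
    using \<mu> by (simp_all add: representing_measure_def)
  obtain c where c: "p = poly_of c" using p by (auto simp: nonneg_polys_def symP_def polyP_def)
  let ?t = "\<lambda>x a. qRe (heval a (hword (fst x) * hconst (Poly_Mapping.lookup c x) * hword (snd x)))"
  have monomial: "integrable \<mu> (?t x) \<and> (\<integral>a. ?t x a \<partial>\<mu>) = qRe (Poly_Mapping.lookup c x * y (snd x * fst x))" for x
  proof -
    have bl: "bounded_linear (\<lambda>z. qRe (Poly_Mapping.lookup c x * z))"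
      by (rule bounded_linear_compose[OF bounded_linear_qRe bounded_linear_mult_right])
    have eq: "?t x = (\<lambda>a. qRe (Poly_Mapping.lookup c x * word_eval a (snd x * fst x)))"
    proof (rule ext)
      fix a
      have "?t x a = qRe (word_eval a (fst x) * (Poly_Mapping.lookup c x * word_eval a (snd x)))"
        by (simp only: heval_simps mult.assoc)
      also have "\<dots> = qRe ((Poly_Mapping.lookup c x * word_eval a (snd x)) * word_eval a (fst x))"
        by (rule qRe_mult_commute)
      finally show "?t x a = qRe (Poly_Mapping.lookup c x * word_eval a (snd x * fst x))"
        by (simp only: word_eval_simps mult.assoc)
    qed
    show ?thesis
      unfolding eq yw using integrable_bounded_linear[OF bl int] integral_bounded_linear[OF bl int]
      by blast
  qed
  have "L_R y p = (\<Sum>x\<in>Poly_Mapping.keys c. \<integral>a. ?t x a \<partial>\<mu>)"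
    unfolding c L_R_poly_of[OF y] using monomial by (simp add: qRe_sum case_prod_unfold)
  also have "\<dots> = (\<integral>a. qRe (heval a p) \<partial>\<mu>)"
    using monomial
    by (subst Bochner_Integration.integral_sum[symmetric])
      (simp_all only: c poly_of_def heval_sum qRe_sum case_prod_unfold prod.collapse)
  also have "\<dots> \<ge> 0"
  proof (rule integral_nonneg_AE, rule AE_I2)
    fix a assume "a \<in> space \<mu>"
    then have "heval a p \<in> \<real>\<^sub>\<ge>\<^sub>0" using p sp by (simp add: nonneg_polys_def)
    then show "0 \<le> qRe (heval a p)" by (auto elim!: nonneg_Reals_cases)
  qed
  finally show ?thesis .
qed

lemma representing_if_L_R_nonneg:
  fixes K :: "(quat ^ 'n::finite) set"
  assumes K: "closed K" and y: "pseudo_moment y" and nonneg: "\<And>p. p \<in> nonneg_polys K \<Longrightarrow> 0 \<le> L_R y p"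
  shows "\<exists>\<mu>. representing_measure K y \<mu>"
proof -
  obtain \<mu> where \<mu>: "sets \<mu> = sets (restrict_space borel K)"
    and int: "\<And>p. p \<in> symP \<Longrightarrow> integrable \<mu> (\<lambda>a. qRe (heval a p))"
    and eq: "\<And>p. p \<in> symP \<Longrightarrow> (\<integral>a. qRe (heval a p) \<partial>\<mu>) = hL y p"
  \<comment> \<open>\<open>hL\<close> replaces \<open>L_R\<close> because it is linear on the whole
    free product; the two agree on \<open>polyP\<close>.\<close>
  proof (rule positive_extension_representation[OF K subspace_symP, of "hL y" "\<lambda>p a. qRe (heval a p)" 1])
    show "linear (hL y)" by (rule linearI) (simp_all add: hL_add hL_scaleR)
    show "linear (\<lambda>p. qRe (heval a p))" for a by (rule linearI) (simp_all add: heval_scaleR)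
    show "continuous_on UNIV (\<lambda>a. qRe (heval a p))" for p
      by (intro bounded_linear.continuous_on[OF bounded_linear_qRe] continuous_on_heval)
    show "(1 :: 'n hfree) \<in> symP" using hweight_power_symP[of 0] by simp
    show "qRe (heval a 1) = 1" for a by (simp add: heval_one)
    show "0 \<le> hL y p" if p: "p \<in> symP" "\<And>a. a \<in> K \<Longrightarrow> 0 \<le> qRe (heval a p)" for p
    proof -
      have "heval a p \<in> \<real>\<^sub>\<ge>\<^sub>0" if "a \<in> K" for a
        by (subst heval_symP[OF p(1)]) (use p(2)[OF that] in simp)
      then have "0 \<le> L_R y p" using p(1) by (intro nonneg) (simp add: nonneg_polys_def)
      then show ?thesis using L_R_eq_hL[OF y, of p] p(1) by (simp add: symP_def)
    qed
    show "\<exists>v\<in>symP. \<forall>a\<in>K. (1 + norm a) * \<bar>qRe (heval a p)\<bar> \<le> qRe (heval a v)"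
      if "p \<in> symP" for p
      using symP_dominated[OF that] by blast
  qed (rule that)
  have "integrable \<mu> (\<lambda>a. word_eval a w) \<and> y w = (\<integral>a. word_eval a w \<partial>\<mu>)" for w
  proof -
    have ystar: "y (word_star w) = qcnj (y w)"
      using y word_star_simps(3)[of w] unfolding pseudo_moment_def by metis
    have component: "integrable \<mu> (\<lambda>a. inner (word_eval a w) h)"
      "(\<integral>a. inner (word_eval a w) h \<partial>\<mu>) = inner (y w) h" for h
    proof -
      \<comment> \<open>Adding the adjoint of the first monomial puts \<open>p\<close> into
        \<open>symP\<close>. The real parts of the two summands coincide, both under evaluation and,
        by \<open>ystar\<close>, under \<open>hL\<close>, hence the factor 2.\<close>
      define p where "p = hword w * hconst (qcnj h) * hword 1 + hword 1 * hconst h * hword (word_star w)"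
      have p: "p \<in> symP"
      proof -
        have "p \<in> polyP"
          unfolding p_def by (intro subspace_add[OF subspace_polyP] monomial_in_polyP)
        moreover have "hstar p = p" by (simp add: p_def mult.assoc add.commute)
        ultimately show ?thesis by (simp add: symP_def)
      qed
      have "qRe (heval a p) = 2 * inner (word_eval a w) h" for a
        by (simp add: p_def word_eval_star inner_quat_def)
      moreover have "hL y p = 2 * inner (y w) h"
        unfolding p_def hL_add hL_monomial[OF y] mult_1 mult_1_right ystar
        by (simp add: inner_quat_def)
      ultimately have "integrable \<mu> (\<lambda>a. 2 * inner (word_eval a w) h)"
        "(\<integral>a. 2 * inner (word_eval a w) h \<partial>\<mu>) = 2 * inner (y w) h"
        using int[OF p] eq[OF p] by simp_all
      then show "integrable \<mu> (\<lambda>a. inner (word_eval a w) h)"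
        "(\<integral>a. inner (word_eval a w) h \<partial>\<mu>) = inner (y w) h" by simp_all
    qed
    have "integrable \<mu> (\<lambda>a. \<Sum>b\<in>Basis. inner (word_eval a w) b *\<^sub>R b)"
      by (intro Bochner_Integration.integrable_sum integrable_scaleR_left component)
    then have i: "integrable \<mu> (\<lambda>a. word_eval a w)" by (simp add: euclidean_representation)
    then have "inner (\<integral>a. word_eval a w \<partial>\<mu>) h = inner (y w) h" for h
      using component[of h] by simp
    then show ?thesis using i by (metis vector_eq_rdot)
  qed
  then show ?thesis using \<mu> unfolding representing_measure_def by blast
qed

theorem theorem5p6:
  fixes K :: "(quat ^ 'n::finite) set" and y :: "'n word \<Rightarrow> quat"
  assumes "closed K" and "pseudo_moment y"
  shows "(\<exists>\<mu>. representing_measure K y \<mu>) \<longleftrightarrow> (\<forall>p\<in>nonneg_polys K. 0 \<le> L_R y p)"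
  using assms L_R_nonneg_if_representing representing_if_L_R_nonneg by metis

end
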